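(* Let $n$ and $k$ be integers with $n\ge k+1$ and $k\ge 5$. Then $ex_{\mathcal{P}}(n,C_k^+)=ex_{\mathcal{P}}(n,C_k)$.
   Context: All graphs are finite and simple. $C_k$ denotes the cycle on $k$ vertices, and $C_k^+$ denotes the graph obtained from $C_k$ by adding exactly one pendant edge (joining a new vertex) to a vertex of degree two. For a graph $H$, $ex_{\mathcal{P}}(n,H)$ is the maximum number of edges in a planar graph on $n$ vertices that does not contain $H$ as a subgraph. *)

theory Defs
  imports "HOL-Analysis.Analysis"
begin

text \<open>A graph is a pair of a vertex set and a set of edges, an edge being the set of its two ends.\<close>

type_synonym 'a graph = "'a set \<times> 'a set set"

abbreviation verts :: "'a graph \<Rightarrow> 'a set" where "verts \<equiv> fst"
abbreviation edges :: "'a graph \<Rightarrow> 'a set set" where "edges \<equiv> snd"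

definition simple_graph :: "'a graph \<Rightarrow> bool" where
  "simple_graph G \<longleftrightarrow> finite (verts G) \<and> (\<forall>e \<in> edges G. e \<subseteq> verts G \<and> card e = 2)"

definition subgraph :: "'a graph \<Rightarrow> 'a graph \<Rightarrow> bool" where
  "subgraph H G \<longleftrightarrow> simple_graph H \<and> verts H \<subseteq> verts G \<and> edges H \<subseteq> edges G"

definition isomorphic :: "'a graph \<Rightarrow> 'b graph \<Rightarrow> bool" where
  "isomorphic G H \<longleftrightarrow> (\<exists>f. bij_betw f (verts G) (verts H) \<and> edges H = (`) f ` edges G)"

text \<open>Containment is up to isomorphism and the subgraph need not be induced.\<close>

definition contains :: "'a graph \<Rightarrow> 'b graph \<Rightarrow> bool" where
  "contains G H \<longleftrightarrow> (\<exists>G'. subgraph G' G \<and> isomorphic G' H)"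

text \<open>
  The plane is \<open>complex\<close>. Vertices are drawn as distinct points and each edge as an arc between
  its two ends, such that the interior of that arc contains no vertex and no point of another edge.
\<close>

definition plane_drawing ::
    "'a graph \<Rightarrow> ('a \<Rightarrow> complex) \<Rightarrow> ('a set \<Rightarrow> real \<Rightarrow> complex) \<Rightarrow> bool" where
  "plane_drawing G p \<gamma> \<longleftrightarrow>
     inj_on p (verts G) \<and>
     (\<forall>e \<in> edges G. arc (\<gamma> e) \<and> {pathstart (\<gamma> e), pathfinish (\<gamma> e)} = p ` e \<and>
        path_image (\<gamma> e) \<inter> p ` verts G = p ` e) \<and>
     (\<forall>e \<in> edges G. \<forall>f \<in> edges G. e \<noteq> f \<longrightarrow>
        path_image (\<gamma> e) \<inter> path_image (\<gamma> f) \<subseteq> p ` (e \<inter> f))"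

definition planar :: "'a graph \<Rightarrow> bool" where
  "planar G \<longleftrightarrow> (\<exists>p \<gamma>. plane_drawing G p \<gamma>)"

text \<open>Meaningful as \<open>C\<^sub>k\<close> for \<open>k \<ge> 3\<close> only.\<close>

definition cycle_graph :: "nat \<Rightarrow> nat graph" where
  "cycle_graph k = ({..<k}, {{i, Suc i mod k} | i. i < k})"

text \<open>
  All vertices of the cycle have degree two and are equivalent under rotation, so the choice of
  \<open>0\<close> as the end of the pendant edge is immaterial; \<open>k\<close> is the new vertex.
\<close>

definition pendant_cycle_graph :: "nat \<Rightarrow> nat graph" where
  "pendant_cycle_graph k =
     (insert k (verts (cycle_graph k)), insert {0, k} (edges (cycle_graph k)))"

text \<open>
  Every finite graph is isomorphic to one whose vertices are natural numbers, so ranging over these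
  loses nothing.
\<close>

definition planar_free_sizes :: "nat \<Rightarrow> 'b graph \<Rightarrow> nat set" where
  "planar_free_sizes n H =
     {card (edges G) | G :: nat graph.
        simple_graph G \<and> planar G \<and> card (verts G) = n \<and> \<not> contains G H}"

definition ex_planar :: "nat \<Rightarrow> 'b graph \<Rightarrow> nat" where
  "ex_planar n H = Max (planar_free_sizes n H)"

text \<open>The maximum is taken over a finite set, which is nonempty as soon as \<open>H\<close> has an edge.\<close>

lemma finite_planar_free_sizes: "finite (planar_free_sizes n H)"
proof (rule finite_subset)
  show "planar_free_sizes n H \<subseteq> {..2 ^ n}"
  proof
    fix m assume "m \<in> planar_free_sizes n H"
    then obtain G :: "nat graph" where G: "m = card (edges G)" "simple_graph G" "card (verts G) = n"
      by (auto simp: planar_free_sizes_def)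
    then have "edges G \<subseteq> Pow (verts G)" "finite (verts G)"
      by (auto simp: simple_graph_def)
    then have "card (edges G) \<le> card (Pow (verts G))"
      by (intro card_mono) auto
    with G \<open>finite (verts G)\<close> show "m \<in> {..2 ^ n}"
      by (simp add: card_Pow)
  qed
qed simp

lemma planar_free_sizes_nonempty:
  assumes "edges H \<noteq> {}"
  shows "planar_free_sizes n H \<noteq> {}"
proof -
  let ?G = "({..<n}, {}) :: nat graph"
  have "plane_drawing ?G of_nat (\<lambda>_ _. 0)"
    by (simp add: plane_drawing_def inj_on_def)
  then have "planar ?G"
    unfolding planar_def by blast
  moreover have "\<not> contains ?G H"
    using assms by (auto simp: contains_def subgraph_def isomorphic_def)
  moreover have "simple_graph ?G" "card (verts ?G) = n"
    by (simp_all add: simple_graph_def)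
  ultimately have "card (edges ?G) \<in> planar_free_sizes n H"
    unfolding planar_free_sizes_def by blast
  then show ?thesis by blast
qed

end

theory Submission
  imports Defs
begin

text \<open>A cycle \<open>C\<^sub>k\<close> in a graph without \<open>C\<^sub>k\<^sup>+\<close> spans a component, which has \<open>k\<close> vertices and
  by Euler's formula at most \<open>3k - 6\<close> edges. Such a component can be traded for a triangulation on
  \<open>k - 1\<close> vertices and a triangle, glued one after the other at cut vertices to the rest of the graph:
  this uses \<open>(k - 2) + 2\<close> new vertices and \<open>(3(k - 1) - 6) + 3 = 3k - 6\<close> edges, and creates no \<open>C\<^sub>k\<close>
  because all new blocks are too small. If \<open>n = 2k\<close> and the rest contains \<open>C\<^sub>k\<close> as well, two
  triangulations on \<open>k - 1\<close> vertices and a \<open>K\<^sub>4\<close> glued in a row have \<open>2k\<close> vertices and \<open>6k - 12\<close> edges.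

  For the edge bound, Janiszewski's theorem shows that an edge borders at most two faces, and the
  Jordan curve theorem that an edge closing a cycle increases the number of faces; only these two
  inequalities are needed, not Euler's formula itself. For gluing at a vertex \<open>x\<close> of an arbitrary
  drawing, the edges at \<open>x\<close> are first made straight near \<open>x\<close>, which leaves a free sector there.\<close>

section \<open>Arcs in the plane\<close>

text \<open>The trade balances exactly, so whether it can be made is a matter of vertex counts. It
  needs a vertex outside the component to glue at, whence n >= k + 1, and a remainder that is free
  of C_k or still subject to induction. Only a remainder of exactly k vertices may be neither: it is
  too small for the induction and large enough for C_k. That is the case n = 2k, where the whole
  graph is rebuilt from a single vertex; its last block K_4 must have fewer than k vertices, whence
  k >= 5.

  On the topological side the obstacle is that edges are arbitrary arcs, for which the side of an
  edge has no local meaning. Bordering is therefore expressed by deletion: an edge borders a face if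
  the face is no longer one after the edge is erased. An edge then borders at most two faces because
  inserting an edge creates at most two, and double counting bounds the number of faces from above.
  Inserting the edges one at a time bounds it from below.\<close>

lemma arc_image_no_open_subset:
  fixes g :: "real \<Rightarrow> complex"
  assumes g: "arc g" and "open U" "U \<subseteq> path_image g"
  shows "U = {}"
proof (rule ccontr)
  assume "U \<noteq> {}"
  then obtain a r where r: "r > 0" "ball a r \<subseteq> path_image g"
    using assms by (metis all_not_in_conv order_trans openE)
  obtain h where h: "homeomorphism {0..1} (path_image g) g h"
    using g homeomorphism_arc by blast
  let ?I = "h ` ball a r"
  have gh: "g (h x) = x" if "x \<in> ball a r" for x
    using h r that homeomorphism_apply2 by blast
  have cont: "continuous_on (ball a r) h"
    using h r continuous_on_subset homeomorphism_cont2 by blast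
  have inj: "inj_on h (ball a r)"
    by (rule inj_on_inverseI[where g=g]) (rule gh)
  have conn: "connected ?I"
    using cont by (intro connected_continuous_image) auto
  have "a \<in> ball a r" "a + of_real (r/2) \<in> ball a r" "a + of_real (r/2) \<noteq> a"
    using r by (auto simp: dist_norm)
  then obtain s t where st: "s \<in> ?I" "t \<in> ?I" "s < t"
    using inj by (metis imageI inj_onD linorder_neqE_linordered_idom)
  define m where "m = (s + t) / 2"
  have m: "s < m" "m < t"
    using st by (auto simp: m_def)
  have "{s..t} \<subseteq> ?I"
    using connected_contains_Icc[OF conn st(1,2)] .
  then have "m \<in> ?I"
    using m by auto
  then obtain q where q: "q \<in> ball a r" "h q = m"
    by blast
  \<comment> \<open>Deleting one point leaves a disc connected, whereas deleting \<open>m\<close>,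
    which lies strictly between \<open>s\<close> and \<open>t\<close>, disconnects the image of the
    disc on the real line.\<close>
  have "connected (ball a r - {q})"
    by (rule connected_open_delete) auto
  then have "connected (h ` (ball a r - {q}))"
    using cont by (intro connected_continuous_image) (auto intro: continuous_on_subset)
  moreover have "h ` (ball a r - {q}) = ?I - {m}"
    using inj q(1) by (simp add: inj_on_image_set_diff[OF inj] flip: q(2))
  ultimately have "connected (?I - {m})"
    by simp
  then have "{s..t} \<subseteq> ?I - {m}"
    by (rule connected_contains_Icc) (use st(1,2) m in simp_all)
  then have "m \<in> ?I - {m}"
    using m by (meson atLeastAtMost_iff less_imp_le subsetD)
  then show False by simp
qed

lemma connected_complement_Un_finite:
  fixes S :: "complex set"
  assumes "compact S" "connected (- S)" "finite T"
  shows "connected (- (S \<union> T))"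
proof -
  have "connected (- S - T)"
    using assms by (intro connected_open_delete_finite) (auto simp: compact_imp_closed open_Compl)
  then show ?thesis
    by (simp add: Compl_Un Diff_eq)
qed

text \<open>Two edges of a simple graph share at most one end, so no two edges separate the plane.
  This later forces every face to be bordered by three edges.\<close>

lemma connected_complement_two_arcs:
  fixes g h :: "real \<Rightarrow> complex"
  assumes "arc g" "arc h" "path_image g \<inter> path_image h \<subseteq> {z}"
  shows "connected (- (path_image g \<union> path_image h))"
proof (rule Janiszewski_connected)
  show "connected (path_image g \<inter> path_image h)"
    using assms(3) by (auto simp: subset_singleton_iff)
qed (use assms in \<open>auto simp: compact_arc_image closed_arc_image connected_arc_complement\<close>)

text \<open>Two of any three points lie on the same side of a closed curve through the arc, and by
  Janiszewski's theorem such a pair is not separated.\<close>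

lemma arc_no_three_faces_of_cycle:
  fixes g h :: "real \<Rightarrow> complex"
  assumes X: "closed X" and g: "arc g" and h: "arc h" "path_image h \<subseteq> X"
    and ends: "pathstart h = pathfinish g" "pathfinish h = pathstart g"
    and int: "X \<inter> path_image g \<subseteq> {pathstart g, pathfinish g}"
    and abc: "connected_component (- X) a b" "connected_component (- X) b c"
    and off: "a \<notin> path_image g" "b \<notin> path_image g" "c \<notin> path_image g"
  shows "connected_component (- (X \<union> path_image g)) a b \<or>
         connected_component (- (X \<union> path_image g)) b c \<or>
         connected_component (- (X \<union> path_image g)) a c"
proof -
  let ?J = "path_image (g +++ h)"
  have J: "?J = path_image g \<union> path_image h"
    using ends by (simp add: path_image_join)
  have sJ: "simple_path (g +++ h)"
    using assms by (intro simple_path_join_loop) auto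
  have lJ: "pathfinish (g +++ h) = pathstart (g +++ h)"
    using ends by simp
  obtain I Out where IO: "connected I" "connected Out" "I \<union> Out = - ?J"
    using Jordan_curve[OF sJ lJ] by metis
  \<comment> \<open>Janiszewski's theorem requires the curve and the old set to meet in a connected
    set. They meet in the arc \<open>h\<close> alone, because only the ends of \<open>g\<close> can
    lie in \<open>X\<close>, and these lie on \<open>h\<close>.\<close>
  have JX: "?J \<inter> X = path_image h"
  proof -
    have "path_image g \<inter> X \<subseteq> path_image h"
      using int ends pathstart_in_path_image[of h] pathfinish_in_path_image[of h] by auto
    then show ?thesis using J h by auto
  qed
  have un: "?J \<union> X = X \<union> path_image g"
    using J h by auto
  have key: "connected_component (- (X \<union> path_image g)) x y"
    if "connected_component (- X) x y" "x \<in> K" "y \<in> K" "connected K" "K \<subseteq> - ?J" for x y K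
  proof -
    have "connected_component (- (?J \<union> X)) x y"
    proof (rule Janiszewski)
      show "compact ?J" using sJ by (simp add: compact_simple_path_image)
      show "connected (?J \<inter> X)" using JX h(1) by (simp add: connected_arc_image)
      show "connected_component (- ?J) x y"
        using that connected_component_def by metis
    qed (use X that in auto)
    then show ?thesis by (simp add: un)
  qed
  have "a \<in> - ?J" "b \<in> - ?J" "c \<in> - ?J"
    using abc off h connected_component_in unfolding J by fastforce+
  then have "a \<in> I \<union> Out" "b \<in> I \<union> Out" "c \<in> I \<union> Out"
    using IO by auto
  moreover have ac: "connected_component (- X) a c"
    using abc connected_component_trans by metis
  ultimately show ?thesis
    using key[OF abc(1)] key[OF abc(2)] key[OF ac] IO by (metis Un_upper1 Un_upper2 UnE)
qed

text \<open>Janiszewski's theorem applies twice: \<open>g\<close> meets \<open>Y\<close> in one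
  point, and \<open>Z\<close> then meets the union of \<open>g\<close> and \<open>Y\<close> in one
  point. This is the case of an edge that joins two components and separates nothing.\<close>

lemma arc_between_separated_pieces_not_separating:
  fixes g :: "real \<Rightarrow> complex"
  assumes Y: "closed Y" and Z: "compact Z" and YZ: "Y \<inter> Z = {}" and g: "arc g"
    and Yg: "Y \<inter> path_image g = {u}" and Zg: "Z \<inter> path_image g = {v}"
    and ab: "connected_component (- (Y \<union> Z)) a b" and off: "a \<notin> path_image g" "b \<notin> path_image g"
  shows "connected_component (- (Y \<union> Z \<union> path_image g)) a b"
proof -
  have aZ: "connected_component (- Z) a b" and aY: "connected_component (- Y) a b"
    using ab by (auto intro: connected_component_of_subset)
  have ag: "connected_component (- path_image g) a b"
    using g off connected_arc_complement[of g]
    by (auto simp: connected_iff_connected_component)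
  have gY: "connected_component (- (path_image g \<union> Y)) a b"
    using Yg Y ag aY g by (intro Janiszewski) (auto simp: compact_arc_image Int_commute)
  have "connected_component (- (Z \<union> (path_image g \<union> Y))) a b"
  proof (rule Janiszewski[OF Z _ _ aZ])
    show "connected_component (- (path_image g \<union> Y)) a b" by (rule gY)
    show "closed (path_image g \<union> Y)"
      using Y g by (auto simp: closed_arc_image)
    have "Z \<inter> (path_image g \<union> Y) = {v}" using YZ Zg by auto
    then show "connected (Z \<inter> (path_image g \<union> Y))" by simp
  qed
  then show ?thesis by (simp add: Un_ac)
qed

text \<open>A piece that meets the path component of \<open>u\<close> lies inside it. If
  \<open>v\<close> is outside that component, sorting the pieces by whether they meet it gives the
  separation, and finiteness keeps both groups compact.\<close>

lemma path_or_separation: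
  fixes \<A> :: "complex set set"
  assumes fin: "finite \<A>" and pc: "\<And>K. K \<in> \<A> \<Longrightarrow> path_connected K \<and> compact K"
    and u: "u \<in> \<Union>\<A>" and v: "v \<in> \<Union>\<A>"
  obtains "path_component (\<Union>\<A>) u v"
  | Y Z where "compact Y" "compact Z" "Y \<inter> Z = {}" "Y \<union> Z = \<Union>\<A>" "u \<in> Y" "v \<in> Z"
proof (cases "path_component (\<Union>\<A>) u v")
  case False
  let ?P = "path_component_set (\<Union>\<A>) u"
  let ?Y = "\<Union>{K\<in>\<A>. K \<inter> ?P \<noteq> {}}" and ?Z = "\<Union>{K\<in>\<A>. K \<inter> ?P = {}}"
  have sub: "K \<subseteq> ?P" if "K \<in> \<A>" "K \<inter> ?P \<noteq> {}" for K
  proof -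
    obtain w where w: "w \<in> K" "path_component (\<Union>\<A>) u w"
      using \<open>K \<inter> ?P \<noteq> {}\<close> by auto
    have "path_component (\<Union>\<A>) w x" if "x \<in> K" for x
      using pc[OF \<open>K \<in> \<A>\<close>] w that \<open>K \<in> \<A>\<close>
      by (meson Union_upper path_component_of_subset path_connected_component)
    then show ?thesis
      using w path_component_trans by (auto, blast)
  qed
  have YP: "?Y \<subseteq> ?P" using sub by blast
  have "u \<in> ?P" using u by (auto simp: path_component_refl_eq)
  show ?thesis
  proof (rule that(2)[of ?Y ?Z])
    show "compact ?Y" "compact ?Z" using fin pc by (auto intro!: compact_Union)
    show "?Y \<inter> ?Z = {}" using YP by blast
    show "?Y \<union> ?Z = \<Union>\<A>" by auto
    show "u \<in> ?Y" using u \<open>u \<in> ?P\<close> by blast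
    show "v \<in> ?Z" using v False YP by blast
  qed
qed

text \<open>If the old pieces already join the ends of \<open>g\<close>, the arc closes a Jordan
  curve, which has only two sides. Otherwise it is a bridge between separated compact sets, and
  \<open>a\<close> and \<open>b\<close> stay connected.\<close>

lemma arc_no_three_faces:
  fixes g :: "real \<Rightarrow> complex"
  assumes fin: "finite \<A>" and pc: "\<And>K. K \<in> \<A> \<Longrightarrow> path_connected K \<and> compact K"
    and g: "arc g" and int: "\<Union>\<A> \<inter> path_image g = {pathstart g, pathfinish g}"
    and abc: "connected_component (- \<Union>\<A>) a b" "connected_component (- \<Union>\<A>) b c"
    and off: "a \<notin> path_image g" "b \<notin> path_image g" "c \<notin> path_image g"
  shows "connected_component (- (\<Union>\<A> \<union> path_image g)) a b \<or>
         connected_component (- (\<Union>\<A> \<union> path_image g)) b c \<or>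
         connected_component (- (\<Union>\<A> \<union> path_image g)) a c"
proof -
  have ne: "pathfinish g \<noteq> pathstart g" using g arc_distinct_ends by blast
  have cl: "closed (\<Union>\<A>)"
    using fin pc by (intro closed_Union ballI) (auto simp: compact_imp_closed)
  have mem: "pathfinish g \<in> \<Union>\<A>" "pathstart g \<in> \<Union>\<A>" using int by auto
  show ?thesis
  proof (rule path_or_separation[OF fin pc mem])
    assume "path_component (\<Union>\<A>) (pathfinish g) (pathstart g)"
    then obtain h where h: "path h" "path_image h \<subseteq> \<Union>\<A>"
      "pathstart h = pathfinish g" "pathfinish h = pathstart g"
      by (auto simp: path_component_def)
    \<comment> \<open>The path \<open>h\<close> may cross itself, while a Jordan curve needs an
      arc.\<close>
    obtain k where k: "arc k" "path_image k \<subseteq> path_image h" "pathstart k = pathfinish g"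
      "pathfinish k = pathstart g"
      using path_contains_arc[OF h(1) h(3,4)] ne by metis
    show ?thesis
    proof (rule arc_no_three_faces_of_cycle[OF cl g k(1) _ k(3,4) _ abc off])
      show "path_image k \<subseteq> \<Union>\<A>" using k(2) h(2) by (rule order_trans)
      show "\<Union>\<A> \<inter> path_image g \<subseteq> {pathstart g, pathfinish g}" using int by simp
    qed
  next
    fix Y Z assume YZ: "compact Y" "compact Z" "Y \<inter> Z = {}" "Y \<union> Z = \<Union>\<A>"
      "pathfinish g \<in> Y" "pathstart g \<in> Z"
    have "Y \<inter> path_image g = {pathfinish g}" "Z \<inter> path_image g = {pathstart g}"
    proof -
      have "(Y \<union> Z) \<inter> path_image g = {pathstart g, pathfinish g}"
        unfolding YZ(4) by (rule int)
      then have "Y \<inter> path_image g \<union> Z \<inter> path_image g = {pathstart g, pathfinish g}"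
        by (simp add: Int_Un_distrib2)
      moreover have "pathstart g \<notin> Y \<inter> path_image g" "pathfinish g \<notin> Z \<inter> path_image g"
        using YZ(3,5,6) by auto
      moreover have "P = {y} \<and> Q = {x}" if "P \<union> Q = {x, y}" "x \<notin> P" "y \<notin> Q" for P Q and x y :: complex
        using that by auto
      ultimately show "Y \<inter> path_image g = {pathfinish g}" "Z \<inter> path_image g = {pathstart g}"
        by blast+
    qed
    then have "connected_component (- (Y \<union> Z \<union> path_image g)) a b"
      by (intro arc_between_separated_pieces_not_separating[where u="pathfinish g" and v="pathstart g"])
        (simp_all add: YZ compact_imp_closed abc off g)
    then show ?thesis by (simp add: YZ(4))
  qed
qed

section \<open>Faces of a plane drawing\<close>

text \<open>Finiteness belongs to the conclusion: when an edge is inserted, it is not known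
  beforehand that the new faces are finite in number.\<close>

lemma finite_card_le_2I:
  assumes "\<And>x y z. \<lbrakk>x \<in> N; y \<in> N; z \<in> N\<rbrakk> \<Longrightarrow> x = y \<or> y = z \<or> x = z"
  shows "finite N \<and> card N \<le> 2"
proof (rule ccontr)
  assume "\<not> ?thesis"
  then have "\<exists>T\<subseteq>N. card T = 3"
    by (metis infinite_arbitrarily_large obtain_subset_with_card_n not_less_eq_eq numeral_3_eq_3 numeral_2_eq_2)
  then show False
    using assms by (auto simp: card_3_iff)
qed

locale drawn_graph =
  fixes V :: "'a set" and E :: "'a set set" and p :: "'a \<Rightarrow> complex" and \<gamma> :: "'a set \<Rightarrow> real \<Rightarrow> complex"
  assumes drawing: "plane_drawing (V, E) p \<gamma>" and simple: "simple_graph (V, E)"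
begin

text \<open>Every vertex belongs to the trace, whatever \<open>S\<close> is. Inserting an edge thus
  adds an arc whose ends are already present.\<close>

definition trace :: "'a set set \<Rightarrow> complex set" where
  "trace S = p ` V \<union> (\<Union>e\<in>S. path_image (\<gamma> e))"

abbreviation faces :: "'a set set \<Rightarrow> complex set set" where
  "faces S \<equiv> components (- trace S)"

lemma finite_verts: "finite V" and finite_edges: "finite E"
proof -
  show "finite V" using simple by (simp add: simple_graph_def)
  moreover have "E \<subseteq> Pow V" using simple by (auto simp: simple_graph_def)
  ultimately show "finite E" by (meson finite_Pow_iff finite_subset)
qed

lemma inj_p: "inj_on p V"
  using drawing by (simp add: plane_drawing_def)

lemma edge_ends: "e \<in> E \<Longrightarrow> e \<subseteq> V \<and> card e = 2"
  using simple by (simp add: simple_graph_def)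

lemma edge_arc:
  assumes "e \<in> E"
  shows "arc (\<gamma> e)" "{pathstart (\<gamma> e), pathfinish (\<gamma> e)} = p ` e" "path_image (\<gamma> e) \<inter> p ` V = p ` e"
  using drawing assms by (simp_all add: plane_drawing_def)

lemma edges_meet:
  assumes "e \<in> E" "f \<in> E" "e \<noteq> f"
  shows "path_image (\<gamma> e) \<inter> path_image (\<gamma> f) \<subseteq> p ` (e \<inter> f)"
  using drawing assms by (simp add: plane_drawing_def)

lemma trace_insert: "trace (insert e S) = trace S \<union> path_image (\<gamma> e)"
  by (auto simp: trace_def)

lemma trace_mono: "S \<subseteq> T \<Longrightarrow> trace S \<subseteq> trace T"
  by (auto simp: trace_def)

lemma trace_Int_edge:
  assumes "S \<subseteq> E" "e \<in> E - S"
  shows "trace S \<inter> path_image (\<gamma> e) = p ` e"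
proof -
  have "path_image (\<gamma> f) \<inter> path_image (\<gamma> e) \<subseteq> p ` e" if "f \<in> S" for f
    using edges_meet[of f e] assms that by auto
  moreover have "p ` V \<inter> path_image (\<gamma> e) = p ` e"
    using edge_arc[of e] assms by (simp add: Int_commute)
  ultimately show ?thesis
    by (auto simp: trace_def)
qed

lemma trace_pieces:
  obtains \<A> where "trace S = \<Union>\<A>" "S \<subseteq> E \<Longrightarrow> finite \<A>"
    "\<And>K. S \<subseteq> E \<Longrightarrow> K \<in> \<A> \<Longrightarrow> path_connected K \<and> compact K"
proof
  let ?A = "(\<lambda>v. {p v}) ` V \<union> (\<lambda>e. path_image (\<gamma> e)) ` S"
  show "trace S = \<Union>?A" by (auto simp: trace_def)
  show "finite ?A" if "S \<subseteq> E"
    using that finite_verts finite_edges finite_subset by auto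
  show "path_connected K \<and> compact K" if "S \<subseteq> E" "K \<in> ?A" for K
    using that edge_arc(1)
    by (auto simp: path_connected_path_image arc_imp_path compact_arc_image)
qed

lemma compact_trace: "S \<subseteq> E \<Longrightarrow> compact (trace S)"
  using trace_pieces[of S] by (metis compact_Union)

lemma open_compl_trace: "S \<subseteq> E \<Longrightarrow> open (- trace S)"
  by (simp add: compact_trace compact_imp_closed open_Compl)

lemma open_face: "S \<subseteq> E \<Longrightarrow> D \<in> faces S \<Longrightarrow> open D"
  using open_components open_compl_trace by blast

lemma face_eqI: "\<lbrakk>C \<in> faces S; D \<in> faces S; x \<in> C; x \<in> D\<rbrakk> \<Longrightarrow> C = D"
  using components_eq by blast

lemma open_edge:
  assumes "e \<in> E"
  shows "connected (path_image (\<gamma> e) - p ` e)" "path_image (\<gamma> e) - p ` e \<noteq> {}"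
  using connected_simple_path_endless[of "\<gamma> e"] nonempty_simple_path_endless[of "\<gamma> e"] edge_arc[OF assms]
  by (simp_all add: arc_imp_simple_path)

text \<open>Inserting an edge is local: only the face \<open>F\<close> containing its interior is
  destroyed. Something replaces \<open>F\<close>, as an arc cannot fill an open set, and at most two
  faces do: of points in three new faces, all inside \<open>F\<close>, two would be connected off
  the arc.\<close>

lemma faces_insert:
  assumes S: "S \<subseteq> E" and e: "e \<in> E - S"
  obtains F where "F \<in> faces S" "F \<notin> faces (insert e S)"
    "faces S - {F} \<subseteq> faces (insert e S)"
    "faces (insert e S) - faces S \<noteq> {}"
    "finite (faces (insert e S) - faces S)" "card (faces (insert e S) - faces S) \<le> 2"
    "path_image (\<gamma> e) - p ` e \<subseteq> F"
proof -
  let ?A = "path_image (\<gamma> e)" and ?N = "faces (insert e S) - faces S"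
  have arc: "arc (\<gamma> e)" using edge_arc e by blast
  have Sub: "- trace (insert e S) \<subseteq> - trace S"
    by (auto simp: trace_insert)
  have out: "?A - p ` e \<subseteq> - trace S"
    using trace_Int_edge[OF S e] by auto
  obtain F where F: "F \<in> faces S" "?A - p ` e \<subseteq> F"
    using exists_component_superset[OF out] open_edge e out by (metis DiffD1 subset_empty)
  have FA: "F \<inter> ?A \<noteq> {}"
    using F open_edge[of e] e by blast
  have notF: "F \<notin> faces (insert e S)"
    using FA in_components_subset[of F] by (auto simp: trace_insert)
  have disj: "D \<inter> ?A = {}" if "D \<in> faces S" "D \<noteq> F" for D
  proof -
    have "D \<inter> F = {}" using that F components_eq by blast
    moreover have "D \<inter> trace S = {}" using that in_components_subset by blast
    ultimately show ?thesis using F trace_Int_edge[OF S e] by blast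
  qed
  have keep: "D \<in> faces (insert e S)" if "D \<in> faces S" "D \<noteq> F" for D
  proof (rule components_intermediate_subset[OF that(1) _ Sub])
    show "D \<subseteq> - trace (insert e S)"
      using disj[OF that] in_components_subset[OF that(1)] by (auto simp: trace_insert)
  qed
  \<comment> \<open>A new face lies in some old face. An old face other than \<open>F\<close>
    survives unchanged and would have to be equal to it.\<close>
  have inF: "D \<subseteq> F" if D: "D \<in> ?N" for D
  proof -
    have "D \<subseteq> - trace S" "connected D" "D \<noteq> {}"
      using D Sub in_components_subset in_components_connected in_components_nonempty by blast+
    then obtain D' where D': "D' \<in> faces S" "D \<subseteq> D'"
      using exists_component_superset by (metis subset_empty)
    have "D' = F"
    proof (rule ccontr)
      assume "D' \<noteq> F"
      then have "D' = D"
        using keep[OF D'(1)] D' D \<open>D \<noteq> {}\<close> face_eqI[of D' "insert e S" D] by blast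
      then show False using D D' by blast
    qed
    then show ?thesis using D' by simp
  qed
  have "\<not> F \<subseteq> ?A"
    using arc_image_no_open_subset[OF arc] open_face[OF S F(1)] in_components_nonempty[OF F(1)] by blast
  then obtain x where x: "x \<in> F" "x \<notin> ?A" by blast
  then have "x \<in> - trace (insert e S)"
    using F in_components_subset by (auto simp: trace_insert)
  then obtain D where D: "D \<in> faces (insert e S)" "x \<in> D"
    by (metis UnionE Union_components)
  then have "D \<in> ?N"
    using notF face_eqI[OF F(1) _ x(1) D(2)] by blast
  then have ne: "?N \<noteq> {}" by blast
  have "finite ?N \<and> card ?N \<le> 2"
  proof (rule finite_card_le_2I)
    fix D1 D2 D3 assume D: "D1 \<in> ?N" "D2 \<in> ?N" "D3 \<in> ?N"
    obtain a where a: "a \<in> D1" using D in_components_nonempty by blast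
    obtain b where b: "b \<in> D2" using D in_components_nonempty by blast
    obtain c where c: "c \<in> D3" using D in_components_nonempty by blast
    have comp: "connected_component (- trace S) x y" if "x \<in> F" "y \<in> F" for x y
      using F(1) that by (meson connected_component_def in_components_connected in_components_subset)
    have off: "x \<notin> ?A" if "x \<in> D" "D \<in> ?N" for x D
      using that in_components_subset by (fastforce simp: trace_insert)
    have same: "D = D'" if "x \<in> D" "y \<in> D'" "D \<in> ?N" "D' \<in> ?N"
        "connected_component (- (trace S \<union> ?A)) x y" for x y D D'
    proof -
      have "x \<in> D'"
        using that components_maximal[of D' "- trace (insert e S)"]
        unfolding connected_component_def trace_insert by (metis DiffD1 IntI empty_iff subsetD)
      then show ?thesis using that face_eqI by blast
    qed
    obtain \<A> where A: "trace S = \<Union>\<A>" "finite \<A>" "\<And>K. K \<in> \<A> \<Longrightarrow> path_connected K \<and> compact K"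
      using trace_pieces[of S] S by metis
    have "connected_component (- (\<Union>\<A> \<union> ?A)) a b \<or>
        connected_component (- (\<Union>\<A> \<union> ?A)) b c \<or> connected_component (- (\<Union>\<A> \<union> ?A)) a c"
    proof (rule arc_no_three_faces[OF A(2,3) arc])
      show "\<Union>\<A> \<inter> ?A = {pathstart (\<gamma> e), pathfinish (\<gamma> e)}"
        using trace_Int_edge[OF S e] edge_arc e A by auto
      show "connected_component (- \<Union>\<A>) a b" "connected_component (- \<Union>\<A>) b c"
        using comp a b c D inF A by auto
    qed (use off a b c D in auto)
    then show "D1 = D2 \<or> D2 = D3 \<or> D1 = D3"
      using same a b c D unfolding A(1)[symmetric] by blast
  qed
  then show thesis
    using that[of F] F notF keep ne by blast
qed

lemma faces_empty: "faces {} = {- p ` V}"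
proof -
  have "connected (- ({} \<union> p ` V))"
    by (rule connected_complement_Un_finite) (auto simp: finite_verts)
  moreover have "- p ` V \<noteq> {}"
    using finite_verts by (metis Compl_eq_Diff_UNIV Diff_eq_empty_iff finite_imageI finite_subset
        infinite_UNIV_char_0)
  ultimately show ?thesis
    by (simp add: trace_def components_eq_sing_iff)
qed

lemma finite_faces:
  assumes "S \<subseteq> E"
  shows "finite (faces S)"
proof -
  have "finite S" using assms finite_edges finite_subset by blast
  from this assms show ?thesis
  proof (induction S rule: finite_subset_induct')
    case empty
    then show ?case by (simp add: faces_empty)
  next
    case (insert e S)
    then have "finite (faces (insert e S) - faces S)"
      using faces_insert[of S e] by blast
    then show ?case using insert by (meson finite_Diff2)
  qed
qed

text \<open>The \<open>+ 1\<close> stands for the one face that is destroyed.\<close>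

lemma card_faces_insert:
  assumes S: "S \<subseteq> E" and e: "e \<in> E - S"
  shows "card (faces (insert e S)) + 1 = card (faces S) + card (faces (insert e S) - faces S)"
proof -
  obtain F where F: "F \<in> faces S" "F \<notin> faces (insert e S)"
    "faces S - {F} \<subseteq> faces (insert e S)"
    using faces_insert[OF S e] by metis
  have fin: "finite (faces S)" "finite (faces (insert e S))"
    using finite_faces S e by auto
  have "faces (insert e S) = (faces S - {F}) \<union> (faces (insert e S) - faces S)"
    using F by blast
  moreover have "card ((faces S - {F}) \<union> (faces (insert e S) - faces S)) =
      card (faces S - {F}) + card (faces (insert e S) - faces S)"
    using fin by (intro card_Un_disjoint) auto
  ultimately have "card (faces (insert e S)) = card (faces S - {F}) + card (faces (insert e S) - faces S)"
    by simp
  then show ?thesis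
    using card_Suc_Diff1[OF fin(1) F(1)] by linarith
qed

lemma card_faces_mono_insert:
  assumes "S \<subseteq> E" "e \<in> E - S"
  shows "card (faces S) \<le> card (faces (insert e S))"
proof -
  have "faces (insert e S) - faces S \<noteq> {}" "finite (faces (insert e S) - faces S)"
    using faces_insert[OF assms] by metis+
  then have "card (faces (insert e S) - faces S) \<ge> 1"
    by (metis Suc_leI card_gt_0_iff One_nat_def)
  then show ?thesis using card_faces_insert[OF assms] by linarith
qed

text \<open>Near an interior point of the new arc, both sides of the closed curve completing that arc
  inside the old drawing are met.\<close>

lemma card_faces_insert_closing:
  assumes S: "S \<subseteq> E" and e: "e \<in> E - S"
    and pc: "path_component (trace S) (pathfinish (\<gamma> e)) (pathstart (\<gamma> e))"
  shows "card (faces S) + 1 \<le> card (faces (insert e S))"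
proof -
  let ?A = "path_image (\<gamma> e)" and ?N = "faces (insert e S) - faces S"
  have arc: "arc (\<gamma> e)" using edge_arc e by blast
  have int: "trace S \<inter> ?A = {pathstart (\<gamma> e), pathfinish (\<gamma> e)}"
    using trace_Int_edge[OF S e] edge_arc e by auto
  obtain h where h: "path h" "path_image h \<subseteq> trace S"
      "pathstart h = pathfinish (\<gamma> e)" "pathfinish h = pathstart (\<gamma> e)"
    using pc by (auto simp: path_component_def)
  obtain k where k: "arc k" "path_image k \<subseteq> path_image h" "pathstart k = pathfinish (\<gamma> e)"
      "pathfinish k = pathstart (\<gamma> e)"
    using path_contains_arc[OF h(1) h(3,4)] arc_distinct_ends[OF arc] by metis
  let ?c = "\<gamma> e +++ k"
  have kS: "path_image k \<subseteq> trace S" using k h by blast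
  have J: "path_image ?c = ?A \<union> path_image k"
    using k by (simp add: path_image_join)
  have sc: "simple_path ?c"
  proof (rule simple_path_join_loop)
    show "?A \<inter> path_image k \<subseteq> {pathstart (\<gamma> e), pathstart k}"
      using kS int k by auto
  qed (use arc k in auto)
  have lc: "pathfinish ?c = pathstart ?c" using k by simp
  obtain I Out where IO: "open I" "open Out" "I \<inter> Out = {}" "I \<union> Out = - path_image ?c"
    "frontier I = path_image ?c" "frontier Out = path_image ?c"
    using Jordan_curve[OF sc lc] by metis
  obtain F where F: "F \<in> faces S" "F \<notin> faces (insert e S)" "?A - p ` e \<subseteq> F" "finite ?N"
    using faces_insert[OF S e] by metis
  obtain q where q: "q \<in> ?A - p ` e" using open_edge e by blast
  have "open F" "q \<in> F" using F q open_face S by auto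
  have "q \<in> closure I" "q \<in> closure Out"
    using q IO(5,6) J by (auto simp: frontier_def)
  then obtain a b where ab: "a \<in> I" "a \<in> F" "b \<in> Out" "b \<in> F"
    using \<open>open F\<close> \<open>q \<in> F\<close> by (metis IntE closure_iff_nhds_not_empty disjoint_iff order_refl)
  have out: "x \<in> - trace (insert e S)" if "x \<in> F" "x \<notin> path_image ?c" for x
    using that F(1) in_components_subset J by (fastforce simp: trace_insert)
  have aJ: "a \<notin> path_image ?c" and bJ: "b \<notin> path_image ?c" using ab IO by auto
  obtain Da where Da: "Da \<in> faces (insert e S)" "a \<in> Da"
    using out[OF ab(2) aJ] by (metis UnionE Union_components)
  obtain Db where Db: "Db \<in> faces (insert e S)" "b \<in> Db"
    using out[OF ab(4) bJ] by (metis UnionE Union_components)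
  have N: "Da \<in> ?N" "Db \<in> ?N"
    using F Da Db ab face_eqI by blast+
  have "Da \<noteq> Db"
  proof
    assume "Da = Db"
    have "Da \<subseteq> - path_image ?c"
      using in_components_subset[OF Da(1)] kS unfolding J trace_insert by blast
    then have "Da \<subseteq> I \<union> Out" using IO by simp
    moreover have "connected Da" using Da in_components_connected by blast
    ultimately show False
      using connectedD[of Da I Out] IO ab Da Db \<open>Da = Db\<close> by blast
  qed
  then have "card ?N \<ge> 2"
    using N F(4) card_mono[of ?N "{Da, Db}"] by auto
  then show ?thesis
    using card_faces_insert[OF S e] by linarith
qed

end

section \<open>Components of a graph and the Euler inequality\<close>

definition reach :: "'a set set \<Rightarrow> ('a \<times> 'a) set" where
  "reach S = {(a, b). {a, b} \<in> S}\<^sup>*"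

lemma reach_mono: "S \<subseteq> T \<Longrightarrow> reach S \<subseteq> reach T"
  unfolding reach_def by (rule rtrancl_mono) auto

lemma reach_trans: "(a, b) \<in> reach S \<Longrightarrow> (b, c) \<in> reach S \<Longrightarrow> (a, c) \<in> reach S"
  by (simp add: reach_def)

lemma reach_refl: "(a, a) \<in> reach S"
  by (simp add: reach_def)

text \<open>Taking images under \<open>reach T\<close> sends the class of \<open>v\<close> for
  \<open>S\<close> to its class for \<open>T\<close>. The merging of components thus becomes a
  surjection between sets of classes, which can be counted.\<close>

lemma reach_Image_Image:
  assumes "S \<subseteq> T"
  shows "reach T `` (reach S `` {v}) = reach T `` {v}"
proof
  show "reach T `` (reach S `` {v}) \<subseteq> reach T `` {v}"
  proof
    fix x assume "x \<in> reach T `` (reach S `` {v})"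
    then obtain y where "(v, y) \<in> reach S" "(y, x) \<in> reach T" by blast
    then show "x \<in> reach T `` {v}"
      using reach_mono[OF assms] reach_trans[of v y T x] by blast
  qed
  show "reach T `` {v} \<subseteq> reach T `` (reach S `` {v})"
    by (rule Image_mono[OF subset_refl]) (simp add: reach_refl)
qed

definition reach_classes :: "'a set \<Rightarrow> 'a set set \<Rightarrow> 'a set set" where
  "reach_classes V S = (\<lambda>v. reach S `` {v}) ` V"

lemma reach_classes_image:
  assumes "S \<subseteq> T"
  shows "reach_classes V T = (``) (reach T) ` reach_classes V S"
  unfolding reach_classes_def image_image reach_Image_Image[OF assms] ..

lemma card_reach_classes_mono:
  assumes "finite V" "S \<subseteq> T"
  shows "card (reach_classes V T) \<le> card (reach_classes V S)"
proof -
  have "finite (reach_classes V S)" using assms by (simp add: reach_classes_def)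
  then show ?thesis
    unfolding reach_classes_image[OF assms(2)] by (rule card_image_le)
qed

text \<open>The classes of \<open>u\<close> and \<open>v\<close> are different for \<open>S\<close>
  but have the same image, so the surjection onto the new classes is not injective.\<close>

lemma card_reach_classes_insert:
  assumes "finite V" "u \<in> V" "v \<in> V" "(u, v) \<notin> reach S"
  shows "card (reach_classes V (insert {u, v} S)) + 1 \<le> card (reach_classes V S)"
proof -
  let ?T = "insert {u, v} S"
  let ?f = "(``) (reach ?T)"
  have fin: "finite (reach_classes V S)" using assms by (simp add: reach_classes_def)
  have uv: "(u, v) \<in> reach ?T" "(v, u) \<in> reach ?T"
    unfolding reach_def by (auto simp: insert_commute)
  have "?f (reach S `` {u}) = ?f (reach S `` {v})"
    unfolding reach_Image_Image[OF subset_insertI]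
    using reach_trans[OF uv(1)] reach_trans[OF uv(2)] by auto
  moreover have "reach S `` {u} \<noteq> reach S `` {v}"
    using assms(4) reach_refl[of v S] by blast
  moreover have "reach S `` {u} \<in> reach_classes V S" "reach S `` {v} \<in> reach_classes V S"
    using assms(2,3) by (simp_all add: reach_classes_def)
  ultimately have "\<not> inj_on ?f (reach_classes V S)"
    by (meson inj_onD)
  then have "card (?f ` reach_classes V S) \<noteq> card (reach_classes V S)"
    using fin eq_card_imp_inj_on by blast
  then have "card (?f ` reach_classes V S) < card (reach_classes V S)"
    using card_image_le[OF fin, of ?f] by linarith
  then show ?thesis
    unfolding reach_classes_image[OF subset_insertI] by simp
qed

context drawn_graph
begin

lemma path_component_reach:
  assumes S: "S \<subseteq> E" and "a \<in> V" "(a, b) \<in> reach S"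
  shows "path_component (trace S) (p a) (p b)"
  using assms(3) unfolding reach_def
proof (induction rule: rtrancl_induct)
  case base
  then show ?case using assms by (simp add: trace_def path_component_refl)
next
  case (step b c)
  then have e: "{b, c} \<in> S" "{b, c} \<in> E" using S by auto
  have "path_connected (path_image (\<gamma> {b, c}))"
    using edge_arc(1)[OF e(2)] by (simp add: arc_imp_path path_connected_path_image)
  moreover have "p b \<in> path_image (\<gamma> {b, c})" "p c \<in> path_image (\<gamma> {b, c})"
    using edge_arc(3)[OF e(2)] by auto
  moreover have "path_image (\<gamma> {b, c}) \<subseteq> trace S"
    using e by (auto simp: trace_def)
  ultimately have "path_component (trace S) (p b) (p c)"
    by (meson path_component_of_subset path_connected_component)
  then show ?case using step path_component_trans by blast
qed

text \<open>Induction over the edges. An edge within a component closes a cycle and adds a face; an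
  edge between components does not lower the number of faces and merges two classes. The
  \<open>1\<close> is the only face of the edgeless drawing.\<close>

lemma euler_lower_bound:
  assumes "S \<subseteq> E"
  shows "card S + card (reach_classes V S) + 1 \<le> card (faces S) + card V"
proof -
  have "finite S" using assms finite_edges finite_subset by blast
  from this assms show ?thesis
  proof (induction S rule: finite_subset_induct')
    case empty
    have "card (reach_classes V {}) \<le> card V"
      unfolding reach_classes_def by (rule card_image_le[OF finite_verts])
    then show ?case by (simp add: faces_empty)
  next
    case (insert e S)
    have e: "e \<in> E - S" using insert by auto
    obtain u v where uv: "pathstart (\<gamma> e) = p u" "pathfinish (\<gamma> e) = p v" "e = {u, v}"
    proof -
      obtain x y where xy: "e = {x, y}"
        using edge_ends[of e] insert by (auto simp: card_2_iff)
      then have "{pathstart (\<gamma> e), pathfinish (\<gamma> e)} = {p x, p y}"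
        using edge_arc(2)[of e] insert by auto
      then show thesis using that xy by (metis doubleton_eq_iff)
    qed
    have V: "u \<in> V" "v \<in> V" using edge_ends[of e] insert uv by auto
    show ?case
    proof (cases "(v, u) \<in> reach S")
      case True
      have "card (faces S) + 1 \<le> card (faces (insert e S))"
        using card_faces_insert_closing[OF insert.hyps(3) e]
          path_component_reach[OF insert.hyps(3) V(2) True] uv by simp
      moreover have "card (reach_classes V (insert e S)) \<le> card (reach_classes V S)"
        by (rule card_reach_classes_mono[OF finite_verts]) auto
      ultimately show ?thesis using insert by simp
    next
      case False
      have "card (faces S) \<le> card (faces (insert e S))"
        by (rule card_faces_mono_insert[OF insert.hyps(3) e])
      moreover have "card (reach_classes V (insert e S)) + 1 \<le> card (reach_classes V S)"
        using card_reach_classes_insert[OF finite_verts V(2,1) False] uv by (simp add: insert_commute)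
      ultimately show ?thesis using insert by simp
    qed
  qed
qed

section \<open>Borders of faces and the bound on the number of edges\<close>

lemma connected_compl_trace:
  assumes S: "S \<subseteq> E" "card S \<le> 2"
  shows "connected (- trace S)"
proof -
  let ?U = "\<Union>e\<in>S. path_image (\<gamma> e)"
  have "finite S" using S finite_edges finite_subset by blast
  have "compact ?U"
    using \<open>finite S\<close> S edge_arc by (intro compact_UN) (auto simp: compact_arc_image)
  moreover have "connected (- ?U)"
  proof -
    consider "S = {}" | e where "S = {e}" | e f where "S = {e, f}" "e \<noteq> f"
    proof -
      have "card S = 0 \<or> card S = 1 \<or> card S = 2" using S by linarith
      then show thesis using that \<open>finite S\<close> by (metis card_0_eq card_1_singletonE card_2_iff)
    qed
    then show ?thesis
    proof cases
      case 2
      then show ?thesis using S edge_arc by (simp add: connected_arc_complement)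
    next
      case 3
      then have ef: "e \<in> E" "f \<in> E" using S by auto
      have "card (e \<inter> f) \<le> 1"
      proof (rule ccontr)
        assume "\<not> ?thesis"
        moreover have "finite e" "finite f" "card e = 2" "card f = 2"
          using edge_ends ef by (auto intro: card_ge_0_finite)
        ultimately have "e \<inter> f = e" "e \<inter> f = f"
          by (intro card_subset_eq card_seteq; simp)+
        then show False using 3 by auto
      qed
      moreover have "finite (e \<inter> f)" using edge_ends[OF ef(1)] finite_verts finite_subset by auto
      ultimately obtain x where "e \<inter> f \<subseteq> {x}"
        by (metis card_le_Suc0_iff_eq One_nat_def subsetI singletonI subset_singleton_iff all_not_in_conv)
      then have "path_image (\<gamma> e) \<inter> path_image (\<gamma> f) \<subseteq> {p x}"
        using edges_meet[OF ef] 3 by blast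
      then show ?thesis
        using connected_complement_two_arcs[of "\<gamma> e" "\<gamma> f"] edge_arc ef 3 by simp
    qed (simp add: connected_UNIV)
  qed
  ultimately have "connected (- (?U \<union> p ` V))"
    by (rule connected_complement_Un_finite) (simp add: finite_verts)
  then show ?thesis by (simp add: trace_def Un_commute)
qed

text \<open>A point of the frontier of \<open>D\<close> that is not a vertex lies on a bordering
  edge, since erasing any other edge leaves \<open>D\<close> a face. So the frontier lies in the
  trace of the border. A border of at most two edges does not separate the plane, hence
  \<open>D\<close> would fill the complement of that trace and leave no room for further
  edges.\<close>

lemma face_border_ge_3:
  assumes E: "card E \<ge> 3" and D: "D \<in> faces E"
  shows "card {e \<in> E. D \<notin> faces (E - {e})} \<ge> 3"
proof (rule ccontr)
  define S where "S = {e \<in> E. D \<notin> faces (E - {e})}"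
  assume "\<not> ?thesis"
  then have card: "card S \<le> 2" by (simp add: S_def)
  have SE: "S \<subseteq> E" by (auto simp: S_def)
  have fr: "frontier D \<subseteq> trace T" if "D \<in> faces T" "T \<subseteq> E" for T
  proof -
    have "frontier D \<subseteq> frontier (- trace T)"
      using that frontier_of_connected_component_subset by (metis componentsE)
    also have "\<dots> \<subseteq> trace T"
      using compact_imp_closed[OF compact_trace[OF that(2)]] by (simp add: frontier_subset_eq)
    finally show ?thesis .
  qed
  have "frontier D \<subseteq> trace S"
  proof
    fix z assume z: "z \<in> frontier D"
    show "z \<in> trace S"
    proof (cases "z \<in> p ` V")
      case False
      then obtain f where f: "f \<in> E" "z \<in> path_image (\<gamma> f)"
        using fr[OF D] z by (auto simp: trace_def)
      have "f \<in> S"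
      proof (rule ccontr)
        assume "f \<notin> S"
        then have "z \<in> trace (E - {f})" using fr[of "E - {f}"] z f by (auto simp: S_def)
        then obtain g where g: "g \<in> E" "g \<noteq> f" "z \<in> path_image (\<gamma> g)"
          using False by (auto simp: trace_def)
        then have "z \<in> p ` (f \<inter> g)" using edges_meet f by blast
        then show False using False edge_ends[OF f(1)] by blast
      qed
      then show ?thesis using f by (auto simp: trace_def)
    qed (auto simp: trace_def)
  qed
  moreover have DS: "D \<subseteq> - trace E" "- trace E \<subseteq> - trace S"
    using D in_components_subset trace_mono[OF SE] by auto
  moreover have "connected (- trace S)" by (rule connected_compl_trace[OF SE card])
  moreover have "D \<noteq> {}" using D in_components_nonempty by blast
  ultimately have "- trace S \<subseteq> D"
    using connected_Int_frontier[of "- trace S" D] by blast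
  then have sub: "trace E \<subseteq> trace S" using DS by blast
  have "E \<subseteq> S"
  proof
    fix f assume f: "f \<in> E"
    show "f \<in> S"
    proof (rule ccontr)
      assume "f \<notin> S"
      then have "trace S \<inter> path_image (\<gamma> f) = p ` f" using trace_Int_edge[OF SE] f by blast
      moreover have "path_image (\<gamma> f) \<subseteq> trace S" using sub f by (auto simp: trace_def)
      ultimately show False using open_edge(2)[OF f] by blast
    qed
  qed
  then show False using card E SE by (simp add: subset_antisym)
qed

text \<open>Double counting of the pairs of a face and an edge bordering it. The faces bordered by
  \<open>e\<close> are those created when \<open>e\<close> is inserted last.\<close>

lemma three_card_faces_le:
  assumes "card E \<ge> 3"
  shows "3 * card (faces E) \<le> 2 * card E"
proof -
  have fin: "finite (faces E)" by (simp add: finite_faces)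
  have "3 * card (faces E) \<le> (\<Sum>D\<in>faces E. card {e \<in> E. D \<notin> faces (E - {e})})"
    using sum_mono[of "faces E" "\<lambda>_. 3" "\<lambda>D. card {e \<in> E. D \<notin> faces (E - {e})}"]
      face_border_ge_3[OF assms] by simp
  also have "\<dots> = (\<Sum>e\<in>E. card {D \<in> faces E. D \<notin> faces (E - {e})})"
    by (rule sum_multicount_gen) (use fin finite_edges in auto)
  also have "\<dots> \<le> (\<Sum>e\<in>E. 2)"
  proof (rule sum_mono)
    fix e assume e: "e \<in> E"
    then have "E - {e} \<subseteq> E" "e \<in> E - (E - {e})" "insert e (E - {e}) = E" by auto
    then have "card (faces E - faces (E - {e})) \<le> 2"
      using faces_insert[of "E - {e}" e] by metis
    then show "card {D \<in> faces E. D \<notin> faces (E - {e})} \<le> 2"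
      by (simp add: set_diff_eq)
  qed
  finally show ?thesis by (simp add: mult.commute)
qed

text \<open>The Euler inequality bounds the number of faces from below, the border count bounds it
  from above. The latter needs three edges; with at most two, the claim holds by 2 + 6 < 3 *
  3.\<close>

lemma card_edges_le:
  assumes "card V \<ge> 3"
  shows "card E + 6 \<le> 3 * card V"
proof (cases "card E \<ge> 3")
  case True
  have "V \<noteq> {}" using assms by auto
  then have "card (reach_classes V E) \<ge> 1"
    using finite_verts by (simp add: reach_classes_def Suc_le_eq card_gt_0_iff)
  then have "card E + 2 \<le> card (faces E) + card V"
    using euler_lower_bound[of E] by simp
  then show ?thesis using three_card_faces_le[OF True] by linarith
qed (use assms in simp)

end

lemma planar_card_edges_le:
  assumes "simple_graph G" "planar G" "card (verts G) \<ge> 3"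
  shows "card (edges G) + 6 \<le> 3 * card (verts G)"
proof -
  obtain p \<gamma> where "plane_drawing G p \<gamma>"
    using assms unfolding planar_def by blast
  then interpret drawn_graph "verts G" "edges G" p \<gamma>
    by unfold_locales (simp_all add: assms)
  show ?thesis using card_edges_le assms by simp
qed

section \<open>Gluing plane drawings at a vertex\<close>

lemma radii_disjoint:
  fixes c w w' :: complex
  assumes "dist c w = r" "dist c w' = r" "w \<noteq> w'"
  shows "closed_segment w c \<inter> closed_segment w' c \<subseteq> {c}"
proof
  fix z assume z: "z \<in> closed_segment w c \<inter> closed_segment w' c"
  then obtain s t where s: "z - c = s *\<^sub>R (w - c)" "0 \<le> s" and t: "z - c = t *\<^sub>R (w' - c)" "0 \<le> t"
  proof -
    have "z \<in> closed_segment c w" "z \<in> closed_segment c w'"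
      using z by (simp_all add: closed_segment_commute)
    then obtain s t where "0 \<le> s" "z = (1 - s) *\<^sub>R c + s *\<^sub>R w" "0 \<le> t" "z = (1 - t) *\<^sub>R c + t *\<^sub>R w'"
      unfolding closed_segment_def by blast
    moreover have "(1 - a) *\<^sub>R c + a *\<^sub>R y - c = a *\<^sub>R (y - c)" for a :: real and y
      by (simp add: algebra_simps)
    ultimately show thesis using that[of s t] by metis
  qed
  have r: "norm (w - c) = r" "norm (w' - c) = r" "r > 0"
    using assms by (auto simp: dist_norm norm_minus_commute)
  have "s * r = norm (z - c)" "t * r = norm (z - c)"
    unfolding s(1) by (simp add: s r) (simp add: t r flip: s(1))
  then have "s = t" using r by (metis mult_right_cancel less_irrefl)
  then have "s *\<^sub>R (w - c) = s *\<^sub>R (w' - c)" using s(1) t(1) by metis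
  then have "s = 0" using assms(3) by auto
  then show "z \<in> {c}" using s by simp
qed

text \<open>Follow \<open>g\<close> to its first point \<open>w\<close> in the disc and continue
  along the radius. As \<open>w\<close> is the first such point, what is kept before it lies outside
  the disc; any later wandering of \<open>g\<close> is discarded.\<close>

lemma arc_straighten_end:
  fixes g :: "real \<Rightarrow> complex"
  assumes g: "arc g" and fin: "pathfinish g = c" and st: "pathstart g \<notin> cball c r" and r: "r > 0"
  obtains h w where "arc h" "pathstart h = pathstart g" "pathfinish h = c" "dist c w = r"
    "w \<in> path_image g" "path_image h \<subseteq> (path_image g - cball c r) \<union> closed_segment w c"
proof -
  have "pathfinish g \<notin> - cball c r" using fin r by simp
  then obtain u where u: "0 \<le> u" "u \<le> 1" "\<And>t. 0 \<le> t \<and> t < u \<Longrightarrow> g t \<in> interior (- cball c r)"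
    "g u \<notin> interior (- cball c r)" "u = 0 \<or> g u \<in> closure (- cball c r)"
    using subpath_to_frontier_explicit[of g "- cball c r"] arc_imp_path[OF g] by metis
  have int: "interior (- cball c r) = - cball c r"
    by (simp add: interior_open open_Compl)
  have "u \<noteq> 0" using u(4) st by (auto simp: int pathstart_def)
  then have "g u \<in> closure (- cball c r)" using u by blast
  then have "g u \<notin> ball c r" by (simp add: closure_complement)
  moreover have in_cball: "g u \<in> cball c r" using u(4) int by simp
  ultimately have d: "dist c (g u) = r" by simp
  have gu: "g u \<in> path_image g" using u by (simp add: path_image_def)
  let ?s = "subpath 0 u g" and ?l = "linepath (g u) c"
  have "path_image ?s = g ` {0..u}" using u by (simp add: path_image_subpath)
  also have "\<dots> = g ` {0..<u} \<union> {g u}"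
    using u by (metis atLeastLessThan_singleton atLeastAtMost_singleton image_Un image_insert image_empty ivl_disj_un_singleton(6))
  finally have s: "path_image ?s \<subseteq> (path_image g - cball c r) \<union> {g u}"
    using u int by (fastforce simp: path_image_def)
  have l: "closed_segment (g u) c \<subseteq> cball c r"
    using in_cball r by (intro closed_segment_subset) auto
  have arc: "arc (?s +++ ?l)"
  proof (rule arc_join)
    show "arc ?s" using g u \<open>u \<noteq> 0\<close> by (intro arc_subpath_arc) auto
    show "arc ?l" using d r by (intro arc_linepath) auto
    show "path_image ?s \<inter> path_image ?l \<subseteq> {pathstart ?l}" using s l by auto
  qed simp
  show thesis
  proof (rule that[OF arc _ _ d gu])
    show "path_image (?s +++ ?l) \<subseteq> (path_image g - cball c r) \<union> closed_segment (g u) c"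
      using s by (auto simp: path_image_join)
  qed (auto simp: pathstart_def[of g])
qed

context drawn_graph
begin

lemma radial_redrawing:
  assumes x: "x \<in> V"
  obtains \<gamma>' W r where "plane_drawing (V, E) p \<gamma>'" "r > 0" "finite W" "p x \<notin> W"
    "(p ` V \<union> (\<Union>e\<in>E. path_image (\<gamma>' e))) \<inter> cball (p x) r \<subseteq> insert (p x) (\<Union>w\<in>W. closed_segment w (p x))"
proof -
  \<comment> \<open>Everything not incident with \<open>x\<close> forms a compact set that misses
    \<open>p x\<close>, so a small disc around \<open>p x\<close> meets no vertex but
    \<open>x\<close> and no edge but those at \<open>x\<close>.\<close>
  define K where "K = p ` (V - {x}) \<union> (\<Union>e\<in>{e\<in>E. x \<notin> e}. path_image (\<gamma> e))"
  have "compact K"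
    unfolding K_def using finite_verts finite_edges edge_arc(1)
    by (intro compact_Un compact_UN) (auto simp: finite_imp_compact compact_arc_image)
  then have "open (- K)" using compact_imp_closed open_Compl by blast
  have px_edge: "x \<in> e" if "e \<in> E" "p x \<in> path_image (\<gamma> e)" for e
  proof -
    have "p x \<in> p ` e" using edge_arc(3)[of e] that x by blast
    then show ?thesis using inj_p edge_ends[of e] that x by (meson inj_on_image_mem_iff)
  qed
  have "p x \<notin> p ` (V - {x})"
    using inj_p x by (meson Diff_iff Diff_subset inj_on_image_mem_iff insertI1)
  then have "p x \<in> - K" using px_edge by (auto simp: K_def)
  then obtain r where r: "r > 0" "cball (p x) r \<subseteq> - K"
    using \<open>open (- K)\<close> by (meson open_contains_cball)
  have Vball: "v = x" if "v \<in> V" "p v \<in> cball (p x) r" for v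
    using r(2) that by (auto simp: K_def)
  define good where "good e h w \<longleftrightarrow> arc h \<and> {pathstart h, pathfinish h} = p ` e \<and> dist (p x) w = r \<and>
    w \<in> path_image (\<gamma> e) \<and> path_image h \<subseteq> (path_image (\<gamma> e) - cball (p x) r) \<union> closed_segment w (p x)"
    for e h w
  have "\<exists>h w. good e h w" if e: "e \<in> E" "x \<in> e" for e
  proof -
    obtain y where y: "e = {x, y}" "y \<noteq> x"
      using edge_ends[OF e(1)] e(2) by (auto simp: card_2_iff)
    have yV: "y \<in> V" using edge_ends[OF e(1)] y by simp
    then have yb: "p y \<notin> cball (p x) r" using Vball y by blast
    have ends: "{pathstart (\<gamma> e), pathfinish (\<gamma> e)} = {p x, p y}"
      using edge_arc(2)[OF e(1)] y by simp
    obtain g where g: "arc g" "pathstart g = p y" "pathfinish g = p x" "path_image g = path_image (\<gamma> e)"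
    proof (cases "pathfinish (\<gamma> e) = p x")
      case True
      then have "pathstart (\<gamma> e) = p y" using ends by (metis doubleton_eq_iff)
      then show thesis using that[of "\<gamma> e"] True edge_arc(1)[OF e(1)] by blast
    next
      case False
      then have "pathfinish (\<gamma> e) = p y" "pathstart (\<gamma> e) = p x" using ends by (metis doubleton_eq_iff)+
      then show thesis
        using that[of "reversepath (\<gamma> e)"] edge_arc(1)[OF e(1)] by (simp add: arc_reversepath)
    qed
    have "pathstart g \<notin> cball (p x) r" using g yb by simp
    then obtain h w where h: "arc h" "pathstart h = pathstart g" "pathfinish h = p x" "dist (p x) w = r"
      "w \<in> path_image g" "path_image h \<subseteq> (path_image g - cball (p x) r) \<union> closed_segment w (p x)"
      by (rule arc_straighten_end[OF g(1,3) _ r(1)])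
    have "good e h w"
      unfolding good_def using h g y by auto
    then show ?thesis by blast
  qed
  then obtain h w where hw: "\<And>e. e \<in> E \<Longrightarrow> x \<in> e \<Longrightarrow> good e (h e) (w e)"
    by metis
  define \<gamma>' where "\<gamma>' e = (if x \<in> e then h e else \<gamma> e)" for e
  have seg: "closed_segment (w e) (p x) \<subseteq> cball (p x) r" if "e \<in> E" "x \<in> e" for e
    using hw[OF that] r by (intro closed_segment_subset) (auto simp: good_def)
  have far: "path_image (\<gamma> e) \<inter> cball (p x) r = {}" if "e \<in> E" "x \<notin> e" for e
    using r(2) that by (auto simp: K_def)
  have split: "path_image (\<gamma>' e) \<subseteq> (path_image (\<gamma> e) - cball (p x) r) \<union> (if x \<in> e then closed_segment (w e) (p x) else {})"
    if "e \<in> E" for e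
    using hw[OF that] far[OF that] by (auto simp: \<gamma>'_def good_def)
  \<comment> \<open>Different edges enter the disc at different points: they could share only a
    vertex, and no vertex lies on the circle. Hence the new radii meet only at the centre.\<close>
  have wne: "w e \<noteq> w f" if "e \<in> E" "f \<in> E" "x \<in> e" "x \<in> f" "e \<noteq> f" for e f
  proof
    assume eq: "w e = w f"
    have "w e \<in> path_image (\<gamma> e)" "w e \<in> path_image (\<gamma> f)" "dist (p x) (w e) = r"
      using hw[of e] hw[of f] that eq by (simp_all add: good_def)
    then have "w e \<in> p ` (e \<inter> f)" using edges_meet[of e f] that by blast
    then obtain v where v: "v \<in> e" "w e = p v" by blast
    then have "v \<in> V" using edge_ends[OF that(1)] by blast
    then have "v = x" using Vball v \<open>dist (p x) (w e) = r\<close> by simp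
    then show False using v \<open>dist (p x) (w e) = r\<close> r by simp
  qed
  have draw: "plane_drawing (V, E) p \<gamma>'"
    unfolding plane_drawing_def fst_conv snd_conv
  proof (intro conjI ballI impI)
    fix e assume e: "e \<in> E"
    show "arc (\<gamma>' e)" using hw[OF e] edge_arc(1)[OF e] by (simp add: \<gamma>'_def good_def)
    show ends: "{pathstart (\<gamma>' e), pathfinish (\<gamma>' e)} = p ` e"
      using hw[OF e] edge_arc[OF e] by (simp add: \<gamma>'_def good_def)
    show "path_image (\<gamma>' e) \<inter> p ` V = p ` e"
    proof
      show "p ` e \<subseteq> path_image (\<gamma>' e) \<inter> p ` V"
      proof (rule Int_greatest)
        show "p ` e \<subseteq> path_image (\<gamma>' e)" unfolding ends[symmetric] by (simp add: pathstart_in_path_image pathfinish_in_path_image)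
        show "p ` e \<subseteq> p ` V" using edge_ends[OF e] by (simp add: image_mono)
      qed
      show "path_image (\<gamma>' e) \<inter> p ` V \<subseteq> p ` e"
      proof
        fix z assume z: "z \<in> path_image (\<gamma>' e) \<inter> p ` V"
        then obtain v where v: "v \<in> V" "z = p v" by blast
        consider "z \<in> path_image (\<gamma> e)" | "x \<in> e" "z \<in> closed_segment (w e) (p x)"
          using split[OF e] z by (auto split: if_splits)
        then show "z \<in> p ` e"
        proof cases
          case 1
          then show ?thesis using edge_arc(3)[OF e] v by blast
        next
          case 2
          then have "v = x" using seg[OF e] v Vball by blast
          then show ?thesis using 2 v by simp
        qed
      qed
    qed
  next
    fix e f assume e: "e \<in> E" and f: "f \<in> E" and ef: "e \<noteq> f"
    show "path_image (\<gamma>' e) \<inter> path_image (\<gamma>' f) \<subseteq> p ` (e \<inter> f)"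
    proof
      fix z assume z: "z \<in> path_image (\<gamma>' e) \<inter> path_image (\<gamma>' f)"
      show "z \<in> p ` (e \<inter> f)"
      proof (cases "z \<in> cball (p x) r")
        case False
        have "z \<in> path_image (\<gamma> e)" "z \<in> path_image (\<gamma> f)"
          using False z split[OF e] split[OF f] seg[OF e] seg[OF f] by (auto split: if_splits)
        then show ?thesis using edges_meet[OF e f ef] by blast
      next
        case True
        then have xe: "x \<in> e" "x \<in> f"
          and zs: "z \<in> closed_segment (w e) (p x)" "z \<in> closed_segment (w f) (p x)"
          using z split[OF e] split[OF f] by (auto split: if_splits)
        have "dist (p x) (w e) = r" "dist (p x) (w f) = r"
          using hw e f xe by (auto simp: good_def)
        then have "z = p x"
          using radii_disjoint[of "p x" "w e" r "w f"] wne[OF e f xe ef] zs by blast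
        then show ?thesis using xe by blast
      qed
    qed
  qed (rule inj_p)
  show thesis
  proof (rule that[OF draw r(1)])
    show "finite (w ` {e \<in> E. x \<in> e})" using finite_edges by simp
    show "p x \<notin> w ` {e \<in> E. x \<in> e}"
      using hw r unfolding good_def by fastforce
    show "(p ` V \<union> (\<Union>e\<in>E. path_image (\<gamma>' e))) \<inter> cball (p x) r
        \<subseteq> insert (p x) (\<Union>w\<in>w ` {e \<in> E. x \<in> e}. closed_segment w (p x))"
    proof
      fix z assume z: "z \<in> (p ` V \<union> (\<Union>e\<in>E. path_image (\<gamma>' e))) \<inter> cball (p x) r"
      then consider v where "v \<in> V" "z = p v" | e where "e \<in> E" "z \<in> path_image (\<gamma>' e)" by blast
      then show "z \<in> insert (p x) (\<Union>w\<in>w ` {e \<in> E. x \<in> e}. closed_segment w (p x))"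
      proof cases
        case 1
        then have "v = x" using Vball z by auto
        then show ?thesis using 1 by simp
      next
        case 2
        then have "x \<in> e" "z \<in> closed_segment (w e) (p x)"
          using split[of e] z by (auto split: if_splits)
        then show ?thesis using 2 by blast
      qed
    qed
  qed
qed

end

text \<open>The apex is left out, since this is where the two drawings are to meet. The lower side,
  the positive real axis, is included because it carries an edge of the block.\<close>

definition sector :: "real \<Rightarrow> complex set" where
  "sector \<eta> = {z. Re z > 0 \<and> 0 \<le> Im z \<and> Im z \<le> \<eta> * Re z}"

lemma sector_scale: "s > 0 \<Longrightarrow> of_real s * z \<in> sector \<eta> \<longleftrightarrow> z \<in> sector \<eta>"
  by (simp add: sector_def zero_less_mult_iff zero_le_mult_iff mult.left_commute[of \<eta>])

lemma free_directions:
  assumes "finite W" "0 \<notin> W"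
  obtains d \<eta> where "norm d = 1" "\<eta> > 0" "\<And>w. w \<in> W \<Longrightarrow> w / d \<notin> sector \<eta>"
proof -
  have "infinite (sphere (0::complex) 1)"
  proof
    assume "finite (sphere (0::complex) 1)"
    moreover have "connected (sphere (0::complex) 1)" by (rule connected_sphere) simp
    moreover have "1 \<in> sphere (0::complex) 1" "-1 \<in> sphere (0::complex) 1" by simp_all
    ultimately have "(1::complex) = -1"
      using connected_finite_iff_sing by (metis empty_iff singletonD)
    then show False by simp
  qed
  then obtain d where d: "d \<in> sphere 0 1" "d \<notin> (\<lambda>w. w / of_real (norm w)) ` W"
    using assms(1) by (metis finite_imageI finite_subset subsetI)
  have "\<exists>\<eta>>0. \<forall>w\<in>W. w / d \<notin> sector \<eta>"
    using assms d(2)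
  proof (induction W rule: finite_induct)
    case empty
    show ?case by (auto intro: exI[of _ 1])
  next
    case (insert w W)
    then obtain \<eta> where \<eta>: "\<eta> > 0" "\<forall>w\<in>W. w / d \<notin> sector \<eta>" by auto
    let ?z = "w / d"
    have dn: "d \<noteq> 0" "norm d = 1" using d by auto
    have "\<not> (Im ?z = 0 \<and> Re ?z > 0)"
    proof
      assume z: "Im ?z = 0 \<and> Re ?z > 0"
      then have "?z = of_real (Re ?z)" by (simp add: complex_eq_iff)
      then have w: "w = of_real (Re ?z) * d" using dn by (metis nonzero_mult_div_cancel_right nonzero_eq_divide_eq)
      have "norm w = Re ?z" using dn z by (subst w) (simp add: norm_mult)
      then have "d = w / of_real (norm w)" using w z by (metis less_irrefl nonzero_mult_div_cancel_left of_real_eq_0_iff)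
      then show False using insert.prems by auto
    qed
    then have "\<exists>\<epsilon>>0. ?z \<notin> sector \<epsilon>"
    proof -
      assume a: "\<not> (Im ?z = 0 \<and> Re ?z > 0)"
      show ?thesis
      proof (cases "Re ?z > 0 \<and> Im ?z > 0")
        case True
        \<comment> \<open>Half the slope of \<open>?z\<close>: the sector contains its upper side,
          so the slope itself would be too large.\<close>
        then have "Im ?z / (2 * Re ?z) > 0" "?z \<notin> sector (Im ?z / (2 * Re ?z))"
          by (auto simp: sector_def)
        then show ?thesis by blast
      next
        case False
        then show ?thesis using a by (intro exI[of _ 1]) (auto simp: sector_def)
      qed
    qed
    then obtain \<epsilon> where \<epsilon>: "\<epsilon> > 0" "?z \<notin> sector \<epsilon>" by blast
    have mono: "sector (min \<epsilon> \<eta>) \<subseteq> sector \<epsilon>" "sector (min \<epsilon> \<eta>) \<subseteq> sector \<eta>"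
      unfolding sector_def by (auto intro: order_trans mult_right_mono)
    show ?case using \<eta> \<epsilon> mono by (intro exI[of _ "min \<epsilon> \<eta>"]) auto
  qed
  then show thesis using that[of d] d by auto
qed

context drawn_graph
begin

text \<open>The bound \<open>Re z \<le> 2\<close> is the extent of the block to be inserted.
  Multiplication by \<open>d\<close> rotates and rescales this part of the sector so that it fits
  into the disc where all edges are radii.\<close>

lemma free_sector:
  assumes x: "x \<in> V"
  obtains \<gamma>' d \<eta> where "plane_drawing (V, E) p \<gamma>'" "d \<noteq> 0" "\<eta> > 0"
    "\<And>z. z \<in> sector \<eta> \<Longrightarrow> Re z \<le> 2 \<Longrightarrow> p x + d * z \<notin> p ` V \<union> (\<Union>e\<in>E. path_image (\<gamma>' e))"
proof -
  obtain \<gamma>' W r where g: "plane_drawing (V, E) p \<gamma>'" and r: "r > 0" and W: "finite W" "p x \<notin> W" and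
    loc: "(p ` V \<union> (\<Union>e\<in>E. path_image (\<gamma>' e))) \<inter> cball (p x) r \<subseteq> insert (p x) (\<Union>w\<in>W. closed_segment w (p x))"
    using radial_redrawing[OF x] by metis
  obtain b \<eta> where b: "norm b = 1" "\<eta> > 0" "\<And>w. w \<in> (\<lambda>w. w - p x) ` W \<Longrightarrow> w / b \<notin> sector \<eta>"
    proof -
    have "finite ((\<lambda>w. w - p x) ` W)" "0 \<notin> (\<lambda>w. w - p x) ` W" using W by auto
    then show thesis using that by (rule free_directions)
  qed
  \<comment> \<open>A point of the sector with real part at most 2 has imaginary part at most
    \<open>2 * \<eta>\<close>, hence norm at most \<open>2 + 2 * \<eta>\<close>.\<close>
  define t where "t = r / (2 + 2 * \<eta>)"
  have t: "t > 0" using r b by (simp add: t_def)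
  have bn: "b \<noteq> 0" using b by auto
  show thesis
  proof (rule that[OF g _ b(2)])
    show "of_real t * b \<noteq> 0" using t bn by simp
    fix z assume z: "z \<in> sector \<eta>" "Re z \<le> 2"
    let ?q = "p x + of_real t * b * z"
    have "norm z \<le> \<bar>Re z\<bar> + \<bar>Im z\<bar>" by (rule cmod_le)
    also have "\<dots> \<le> 2 + 2 * \<eta>"
    proof -
      have "\<eta> * Re z \<le> \<eta> * 2" using z b by (intro mult_left_mono) auto
      then show ?thesis using z by (auto simp: sector_def)
    qed
    finally have nz: "norm z \<le> 2 + 2 * \<eta>" .
    have "norm (of_real t * b * z) = t * norm z" using t b by (simp add: norm_mult)
    also have "\<dots> \<le> t * (2 + 2 * \<eta>)" using nz t by (intro mult_left_mono) auto
    also have "\<dots> = r" using b by (simp add: t_def)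
    finally have "?q \<in> cball (p x) r" by (simp add: dist_norm)
    moreover have "z \<noteq> 0" using z by (auto simp: sector_def)
    then have "?q \<noteq> p x" using t bn by simp
    moreover have "?q \<notin> closed_segment w (p x)" if w: "w \<in> W" for w
    proof
      assume "?q \<in> closed_segment w (p x)"
      then have "?q \<in> closed_segment (p x) w" by (simp add: closed_segment_commute)
      then obtain s where s: "0 \<le> s" "?q = (1 - s) *\<^sub>R p x + s *\<^sub>R w"
        unfolding closed_segment_def by blast
      then have e: "of_real t * b * z = of_real s * (w - p x)"
        by (simp add: scaleR_conv_of_real algebra_simps)
      then have "s \<noteq> 0" using t bn \<open>z \<noteq> 0\<close> by auto
      then have "(w - p x) / b = of_real (t / s) * z"
        using e bn by (simp add: field_simps)
      moreover have "of_real (t / s) * z \<in> sector \<eta>"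
        using sector_scale[of "t / s"] t s \<open>s \<noteq> 0\<close> z by auto
      ultimately show False using b(3)[OF imageI[OF w]] by metis
    qed
    ultimately show "?q \<notin> p ` V \<union> (\<Union>e\<in>E. path_image (\<gamma>' e))"
      using loc by blast
  qed
qed

end

text \<open>The block is an edge \<open>{0, 1}\<close> joined to the path \<open>2, \<dots>, m - 1\<close>. The path is drawn on the line
  of real part one, and the ends \<open>0\<close> and \<open>1\<close> at \<open>0\<close> and \<open>2\<close>.\<close>

definition block_edges :: "nat \<Rightarrow> nat set set" where
  "block_edges m = insert {0, 1} ((\<lambda>j. {0, j}) ` {2..<m} \<union> (\<lambda>j. {1, j}) ` {2..<m} \<union>
     (\<lambda>j. {j, Suc j}) ` {2..<m - 1})"

definition block_pos :: "real \<Rightarrow> nat \<Rightarrow> complex" where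
  "block_pos h j = (if j = 0 then 0 else if j = 1 then 2 else Complex 1 (h * real j))"

definition block_arc :: "real \<Rightarrow> nat set \<Rightarrow> real \<Rightarrow> complex" where
  "block_arc h e = linepath (block_pos h (Min e)) (block_pos h (Max e))"

text \<open>The count is 1 + 2(m - 2) + (m - 3). For \<open>m = 3\<close> the block is a triangle
  and for \<open>m = 4\<close> it is K_4, so this one family supplies every piece that is
  glued.\<close>

lemma card_block_edges:
  assumes "m \<ge> 3"
  shows "card (block_edges m) + 6 = 3 * m"
proof -
  define A B C :: "nat set set" where "A = (\<lambda>j. {0, j}) ` {2..<m}" and "B = (\<lambda>j. {1, j}) ` {2..<m}"
    and "C = (\<lambda>j. {j, Suc j}) ` {2..<m - 1}"
  have card: "card A = m - 2" "card B = m - 2" "card C = m - 3"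
    unfolding A_def B_def C_def
    by (subst card_image; auto simp: inj_on_def doubleton_eq_iff)+
  have fin: "finite A" "finite B" "finite C"
    by (simp_all add: A_def B_def C_def)
  have mem: "\<And>e. e \<in> A \<Longrightarrow> 0 \<in> e \<and> 1 \<notin> e" "\<And>e. e \<in> B \<Longrightarrow> 0 \<notin> e \<and> 1 \<in> e"
      "\<And>e. e \<in> C \<Longrightarrow> 0 \<notin> e \<and> 1 \<notin> e"
    by (auto simp: A_def B_def C_def)
  have "A \<inter> B = {}" using mem(1,2) by (meson disjoint_iff)
  moreover have "(A \<union> B) \<inter> C = {}" using mem by (meson UnE disjoint_iff)
  moreover have "{0, 1} \<notin> A \<union> B \<union> C" using mem[of "{0, 1}"] by auto
  ultimately have "card (insert {0, 1} (A \<union> B \<union> C)) = Suc (card A + card B + card C)"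
    using fin by (simp add: card_Un_disjoint)
  moreover have "block_edges m = insert {0, 1} (A \<union> B \<union> C)"
    by (simp add: block_edges_def A_def B_def C_def)
  ultimately have "card (block_edges m) = Suc ((m - 2) + (m - 2) + (m - 3))"
    by (simp only: card)
  then show ?thesis using assms by simp
qed

lemma block_edges_cases [consumes 1]:
  assumes "e \<in> block_edges m"
  obtains "e = {0, 1}" | j where "e = {0, j}" "2 \<le> j" "j < m" | j where "e = {1, j}" "2 \<le> j" "j < m"
    | j where "e = {j, Suc j}" "2 \<le> j" "Suc j < m"
  using assms unfolding block_edges_def by fastforce

lemma simple_block: "m \<ge> 2 \<Longrightarrow> simple_graph ({..<m}, block_edges m)"
  unfolding simple_graph_def by (auto elim!: block_edges_cases)

text \<open>Linear conditions on real and imaginary parts replace the parametrized segments, so that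
  crossings can be excluded by arithmetic.\<close>

lemma block_arc_cases [consumes 3]:
  assumes h: "h > 0" and e: "e \<in> block_edges m" and z: "z \<in> path_image (block_arc h e)"
  obtains "e = {0, 1}" "Im z = 0" "0 \<le> Re z" "Re z \<le> 2"
    | j where "e = {0, j}" "2 \<le> j" "j < m" "Im z = h * real j * Re z" "0 \<le> Re z" "Re z \<le> 1"
    | j where "e = {1, j}" "2 \<le> j" "j < m" "Im z = h * real j * (2 - Re z)" "1 \<le> Re z" "Re z \<le> 2"
    | j where "e = {j, Suc j}" "2 \<le> j" "Suc j < m" "Re z = 1" "h * real j \<le> Im z" "Im z \<le> h * real (Suc j)"
proof -
  have seg: "\<exists>u. 0 \<le> u \<and> u \<le> 1 \<and> Re z = (1 - u) * Re a + u * Re b \<and> Im z = (1 - u) * Im a + u * Im b"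
    if "z \<in> closed_segment a b" for a b :: complex
    using that by (auto simp: closed_segment_def)
  from e show thesis
  proof (cases rule: block_edges_cases)
    case 1
    then have "z \<in> closed_segment 0 2" using z by (simp add: block_arc_def block_pos_def)
    then show thesis using that(1) 1 seg by force
  next
    case (2 j)
    then have "z \<in> closed_segment 0 (Complex 1 (h * real j))"
      using z by (simp add: block_arc_def block_pos_def)
    then show thesis using that(2) 2 seg by force
  next
    case (3 j)
    then have "z \<in> closed_segment 2 (Complex 1 (h * real j))"
      using z by (simp add: block_arc_def block_pos_def)
    then obtain u where "0 \<le> u" "u \<le> 1" "Re z = 2 - u" "Im z = u * (h * real j)"
      using seg by force
    then have "Im z = h * real j * (2 - Re z)" "1 \<le> Re z" "Re z \<le> 2" by simp_all
    then show thesis using that(3)[of j] 3 by simp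
  next
    case (4 j)
    then have "z \<in> closed_segment (Complex 1 (h * real j)) (Complex 1 (h * real (Suc j)))"
      using z by (simp add: block_arc_def block_pos_def max_def min_def)
    then obtain u where u: "0 \<le> u" "u \<le> 1" "Re z = 1" "Im z = (1 - u) * (h * real j) + u * (h * real (Suc j))"
      using seg by force
    then have "Im z = h * real j + u * h" by (simp add: algebra_simps)
    moreover have "0 \<le> u * h" "u * h \<le> h" using u h by (auto simp: mult_left_le_one_le)
    ultimately show thesis using that(4)[of j] 4 u by (simp add: algebra_simps)
  qed
qed

lemma block_pos_eqI: "2 \<le> j \<Longrightarrow> Re z = 1 \<Longrightarrow> Im z = h * real j \<Longrightarrow> z = block_pos h j"
  by (simp add: block_pos_def complex_eq_iff)

lemma block_pos_0_eqI: "Re z = 0 \<Longrightarrow> Im z = 0 \<Longrightarrow> z = block_pos h 0"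
  by (simp add: block_pos_def complex_eq_iff)

lemma block_pos_1_eqI: "Re z = 2 \<Longrightarrow> Im z = 0 \<Longrightarrow> z = block_pos h 1"
  by (simp add: block_pos_def complex_eq_iff)

text \<open>The edges from 0 to the path lie left of the line of real part one, those from 1 lie
  right of it, and the path lies on it; the edge \<open>{0, 1}\<close> lies below all of them. Edges
  of the same fan have different slopes, so arcs can meet only at 0, at 1 or on the line, where the
  vertex heights are multiples of \<open>h\<close>.\<close>

lemma block_arcs_meet:
  assumes h: "h > 0" and e: "e \<in> block_edges m" "f \<in> block_edges m" and ef: "e \<noteq> f"
    and z: "z \<in> path_image (block_arc h e)" "z \<in> path_image (block_arc h f)"
  shows "\<exists>v\<in>e \<inter> f. z = block_pos h v"
proof -
  let ?x = "Re z" and ?y = "Im z"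
  have inj: "i = j" if "h * real i * t = h * real j * t" "t \<noteq> 0" for i j t
    using that h by simp
  have le: "i \<le> j" if "h * real i \<le> h * real j" for i j
    using that h by simp
  have pos: "h * real i > 0" if "2 \<le> i" for i using h that by simp
  \<comment> \<open>The digits in the names \<open>P2\<close>, \<open>P3\<close>, \<open>P4\<close>,
    \<open>P44\<close> and \<open>P23\<close> refer to the cases of
    \<open>block_arc_cases\<close>.\<close>
  have P2: "z = block_pos h 0" if "2 \<le> i" "?y = h * real i * ?x" "?x = 0 \<or> ?y = 0" for i
    using that pos[of i] by (intro block_pos_0_eqI) auto
  have P3: "z = block_pos h 1" if "2 \<le> i" "?y = h * real i * (2 - ?x)" "2 - ?x = 0 \<or> ?y = 0" for i
    using that pos[of i] by (intro block_pos_1_eqI) auto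
  have P4: "(i = j \<or> i = Suc j) \<and> z = block_pos h i"
    if "?x = 1" "?y = h * real i" "2 \<le> i" "h * real j \<le> ?y" "?y \<le> h * real (Suc j)" for i j
    using that le[of j i] le[of i "Suc j"] block_pos_eqI[of i z h] by auto
  have P44: "j = Suc i \<and> z = block_pos h j"
    if "?x = 1" "h * real i \<le> ?y" "?y \<le> h * real (Suc i)" "h * real j \<le> ?y" "?y \<le> h * real (Suc j)"
      "i < j" "2 \<le> i" for i j
  proof -
    have "j = Suc i" using that le[of j "Suc i"] by linarith
    then show ?thesis using that block_pos_eqI[of j z h] by simp
  qed
  have P23: "i = j \<and> z = block_pos h i"
    if "?y = h * real i * ?x" "?x \<le> 1" "?y = h * real j * (2 - ?x)" "1 \<le> ?x" "2 \<le> i" for i j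
  proof -
    have "?x = 1" using that by simp
    moreover from this have "i = j" using that h by simp
    ultimately show ?thesis using that block_pos_eqI[of i z h] by simp
  qed
  from h e(1) z(1) show ?thesis
  proof (cases rule: block_arc_cases)
    case e1: 1
    from h e(2) z(2) show ?thesis
    proof (cases rule: block_arc_cases)
      case f1: 1
      show ?thesis using ef e1 f1 by simp
    next
      case f2: (2 j)
      show ?thesis using P2[of j] e1 f2 by simp
    next
      case f3: (3 j)
      show ?thesis using P3[of j] e1 f3 by simp
    next
      case f4: (4 j)
      show ?thesis using pos[of j] e1 f4 by simp
    qed
  next
    case e2: (2 i)
    from h e(2) z(2) show ?thesis
    proof (cases rule: block_arc_cases)
      case f1: 1
      show ?thesis using P2[of i] e2 f1 by simp
    next
      case f2: (2 j)
      show ?thesis using P2[of i] inj[of i ?x j] ef e2 f2 by auto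
    next
      case f3: (3 j)
      show ?thesis using P23[of i j] e2 f3 by auto
    next
      case f4: (4 j)
      show ?thesis using P4[of i j] e2 f4 by auto
    qed
  next
    case e3: (3 i)
    from h e(2) z(2) show ?thesis
    proof (cases rule: block_arc_cases)
      case f1: 1
      show ?thesis using P3[of i] e3 f1 by simp
    next
      case f2: (2 j)
      show ?thesis using P23[of j i] e3 f2 by auto
    next
      case f3: (3 j)
      show ?thesis using P3[of i] inj[of i "2 - ?x" j] ef e3 f3 by auto
    next
      case f4: (4 j)
      show ?thesis using P4[of i j] e3 f4 by auto
    qed
  next
    case e4: (4 i)
    from h e(2) z(2) show ?thesis
    proof (cases rule: block_arc_cases)
      case f1: 1
      show ?thesis using pos[of i] e4 f1 by simp
    next
      case f2: (2 j)
      show ?thesis using P4[of j i] e4 f2 by auto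
    next
      case f3: (3 j)
      show ?thesis using P4[of j i] e4 f3 by auto
    next
      case f4: (4 j)
      show ?thesis using P44[of i j] P44[of j i] ef e4 f4 by (cases i j rule: linorder_cases) auto
    qed
  qed
qed


lemma inj_block_pos: "h > 0 \<Longrightarrow> inj (block_pos h)"
  by (auto simp: inj_def block_pos_def complex_eq_iff split: if_splits)

lemma block_drawing:
  assumes h: "h > 0" and m: "m \<ge> 2"
  shows "plane_drawing ({..<m}, block_edges m) (block_pos h) (block_arc h)"
  unfolding plane_drawing_def fst_conv snd_conv
proof (intro conjI ballI impI)
  show "inj_on (block_pos h) {..<m}" using inj_block_pos[OF h] inj_on_subset by blast
next
  fix e assume e: "e \<in> block_edges m"
  have mm: "Min e \<noteq> Max e" "e = {Min e, Max e}"
    using e by (cases rule: block_edges_cases; simp add: min_def max_def insert_commute)+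
  show ends: "{pathstart (block_arc h e), pathfinish (block_arc h e)} = block_pos h ` e"
    by (subst (3) mm(2)) (simp add: block_arc_def)
  show "arc (block_arc h e)"
    unfolding block_arc_def using mm inj_block_pos[OF h] by (intro arc_linepath) (auto dest: injD)
  show "path_image (block_arc h e) \<inter> block_pos h ` {..<m} = block_pos h ` e"
  proof (rule antisym; rule subsetI)
    fix z assume "z \<in> block_pos h ` e"
    moreover have "e \<subseteq> {..<m}" using simple_block[OF m] e by (simp add: simple_graph_def)
    moreover have "block_pos h ` e \<subseteq> path_image (block_arc h e)"
      unfolding ends[symmetric] by (simp add: pathstart_in_path_image pathfinish_in_path_image)
    ultimately show "z \<in> path_image (block_arc h e) \<inter> block_pos h ` {..<m}" by blast
  next
    fix z assume "z \<in> path_image (block_arc h e) \<inter> block_pos h ` {..<m}"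
    then obtain v where z: "z \<in> path_image (block_arc h e)" and v: "z = block_pos h v" by blast
    have pos: "h * real i > 0" if "i > 0" for i using h that by simp
    have "v = 0 \<and> Re z = 0 \<and> Im z = 0 \<or> v = 1 \<and> Re z = 2 \<and> Im z = 0 \<or>
        v \<ge> 2 \<and> Re z = 1 \<and> Im z = h * real v"
      using v by (auto simp: block_pos_def)
    moreover have "h * real v > 0" if "v \<ge> 2" using pos[of v] that by simp
    ultimately have vz: "v = 0 \<and> Re z = 0 \<and> Im z = 0 \<or> v = 1 \<and> Re z = 2 \<and> Im z = 0 \<or>
        v \<ge> 2 \<and> Re z = 1 \<and> Im z = h * real v \<and> h * real v > 0" by blast
    have le: "i \<le> j" if "h * real i \<le> h * real j" for i j using h that by simp
    from h e z have "v \<in> e"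
    proof (cases rule: block_arc_cases)
      case 1
      then show ?thesis using vz by auto
    next
      case (2 j)
      then show ?thesis using vz le[of j v] le[of v j] by auto
    next
      case (3 j)
      then show ?thesis using vz le[of j v] le[of v j] by auto
    next
      case (4 j)
      then show ?thesis using vz le[of j v] le[of v "Suc j"] by auto
    qed
    then show "z \<in> block_pos h ` e" using v by blast
  qed
next
  fix e f assume "e \<in> block_edges m" "f \<in> block_edges m" "e \<noteq> f"
  then show "path_image (block_arc h e) \<inter> path_image (block_arc h f) \<subseteq> block_pos h ` (e \<inter> f)"
    using block_arcs_meet[OF h] by blast
qed

text \<open>Decreasing \<open>h\<close> flattens the block and leaves the gluing point 0 fixed, so
  the block fits into any sector, however thin.\<close>

lemma block_in_sector:
  assumes h: "h > 0" "h * real m \<le> \<eta>" and m: "m \<ge> 2"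
    and z: "z \<in> block_pos h ` {..<m} \<union> (\<Union>e\<in>block_edges m. path_image (block_arc h e))" "z \<noteq> 0"
  shows "z \<in> sector \<eta> \<and> Re z \<le> 2"
proof -
  \<comment> \<open>Every other vertex is joined to 0, so only points on edges need to be
    considered.\<close>
  have "\<exists>e\<in>block_edges m. z \<in> path_image (block_arc h e)"
  proof (cases "z \<in> block_pos h ` {..<m}")
    case True
    then obtain v where v: "v < m" "z = block_pos h v" by blast
    then have "v \<noteq> 0" using z(2) by (metis block_pos_def)
    then have e: "{0, v} \<in> block_edges m" using v by (cases "v = 1") (auto simp: block_edges_def)
    then have "z \<in> path_image (block_arc h {0, v})"
      using block_drawing[OF h(1) m] v unfolding plane_drawing_def by fastforce
    then show ?thesis using e by blast
  qed (use z in blast)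
  then obtain e where e: "e \<in> block_edges m" "z \<in> path_image (block_arc h e)" by blast
  have hj: "h * real j \<le> \<eta>" "0 < h * real j" if "0 < j" "j \<le> m" for j
  proof -
    have "h * real j \<le> h * real m" using that h by (intro mult_left_mono) auto
    then show "h * real j \<le> \<eta>" using h by linarith
    show "0 < h * real j" using that h by simp
  qed
  have eta: "\<eta> > 0" using h m by (metis hj le_refl less_le_trans zero_less_numeral order_less_le_trans)
  from h(1) e show ?thesis
  proof (cases rule: block_arc_cases)
    case 1
    then have "Re z \<noteq> 0" using z(2) by (auto simp: complex_eq_iff)
    then show ?thesis using 1 eta by (auto simp: sector_def)
  next
    case (2 j)
    then have "Re z \<noteq> 0" using z(2) by (auto simp: complex_eq_iff)
    moreover have "h * real j * Re z \<le> \<eta> * Re z" "0 \<le> h * real j * Re z"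
      using 2 hj[of j] by (auto intro!: mult_right_mono mult_nonneg_nonneg)
    ultimately show ?thesis using 2 by (auto simp: sector_def)
  next
    case (3 j)
    \<comment> \<open>On the side that descends towards the vertex 1, the height is controlled
      through \<open>2 - Re z \<le> 1 \<le> Re z\<close>.\<close>
    have "h * real j * (2 - Re z) \<le> \<eta> * 1"
      using 3 hj[of j] eta by (intro mult_mono) auto
    moreover have "0 \<le> h * real j * (2 - Re z)"
      using 3 h by (intro mult_nonneg_nonneg) auto
    moreover have "\<eta> * 1 \<le> \<eta> * Re z" using 3 eta by (intro mult_left_mono) auto
    ultimately show ?thesis using 3 by (auto simp: sector_def)
  next
    case (4 j)
    then show ?thesis using hj[of "Suc j"] hj[of j] by (auto simp: sector_def)
  qed
qed

section \<open>Moving, combining and restricting drawings\<close>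

lemma plane_drawing_transport:
  fixes \<phi> :: "complex \<Rightarrow> complex"
  assumes d: "plane_drawing (V, E) p \<gamma>" and E: "\<And>e. e \<in> E \<Longrightarrow> e \<subseteq> V"
    and \<rho>: "inj_on \<rho> V" and \<phi>: "continuous_on UNIV \<phi>" "inj \<phi>"
  shows "plane_drawing (\<rho> ` V, (`) \<rho> ` E) (\<lambda>v. \<phi> (p (inv_into V \<rho> v)))
    (\<lambda>e. \<phi> \<circ> \<gamma> (inv_into V \<rho> ` e))"
proof -
  let ?i = "inv_into V \<rho>"
  have i: "?i (\<rho> v) = v" if "v \<in> V" for v using \<rho> that by simp
  have iV: "(\<lambda>v. \<phi> (p (?i v))) ` \<rho> ` S = \<phi> ` p ` S" if "S \<subseteq> V" for S
    using i that by (force simp: image_image)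
  have ie: "?i ` \<rho> ` S = S" if "S \<subseteq> V" for S
    using i that by (force simp: image_image)
  have ps: "pathstart (\<phi> \<circ> g) = \<phi> (pathstart g)" "pathfinish (\<phi> \<circ> g) = \<phi> (pathfinish g)"
    "path_image (\<phi> \<circ> g) = \<phi> ` path_image g" for g
    by (auto simp: pathstart_def pathfinish_def path_image_def image_comp)
  have arcs: "arc (\<phi> \<circ> g)" if "arc g" for g
  proof -
    have "simple_path (\<phi> \<circ> g)"
      using that \<phi> arc_imp_simple_path
      by (intro simple_path_continuous_image) (auto intro: continuous_on_subset inj_on_subset)
    moreover have "pathfinish (\<phi> \<circ> g) \<noteq> pathstart (\<phi> \<circ> g)"
      using arc_distinct_ends[OF that] \<phi>(2) by (simp add: ps inj_eq)
    ultimately show ?thesis by (simp add: arc_simple_path)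
  qed
  show ?thesis
    unfolding plane_drawing_def fst_conv snd_conv
  proof (intro conjI ballI impI)
    show "inj_on (\<lambda>v. \<phi> (p (?i v))) (\<rho> ` V)"
    proof (rule inj_onI)
      fix a b assume "a \<in> \<rho> ` V" "b \<in> \<rho> ` V" and eq: "\<phi> (p (?i a)) = \<phi> (p (?i b))"
      then obtain u v where u: "u \<in> V" "a = \<rho> u" and v: "v \<in> V" "b = \<rho> v" by blast
      have "p u = p v" using injD[OF \<phi>(2) eq] u v i by simp
      moreover have "inj_on p V" using d by (simp add: plane_drawing_def)
      ultimately show "a = b" using u v by (metis inj_onD)
    qed
  next
    fix e' assume "e' \<in> (`) \<rho> ` E"
    then obtain e where e: "e \<in> E" "e' = \<rho> ` e" by blast
    have D: "arc (\<gamma> e)" "{pathstart (\<gamma> e), pathfinish (\<gamma> e)} = p ` e" "path_image (\<gamma> e) \<inter> p ` V = p ` e"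
      using d e(1) by (simp_all add: plane_drawing_def)
    have e': "?i ` e' = e" "(\<lambda>v. \<phi> (p (?i v))) ` e' = \<phi> ` p ` e"
      using ie[OF E[OF e(1)]] iV[OF E[OF e(1)]] by (simp_all add: e)
    show "arc (\<phi> \<circ> \<gamma> (?i ` e'))" using arcs D e' by simp
    show "{pathstart (\<phi> \<circ> \<gamma> (?i ` e')), pathfinish (\<phi> \<circ> \<gamma> (?i ` e'))} = (\<lambda>v. \<phi> (p (?i v))) ` e'"
      unfolding e' ps D(2)[symmetric] by simp
    show "path_image (\<phi> \<circ> \<gamma> (?i ` e')) \<inter> (\<lambda>v. \<phi> (p (?i v))) ` \<rho> ` V = (\<lambda>v. \<phi> (p (?i v))) ` e'"
      unfolding e' ps iV[OF subset_refl] D(3)[symmetric] by (simp add: image_Int[OF \<phi>(2)])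
  next
    fix e' f' assume "e' \<in> (`) \<rho> ` E" "f' \<in> (`) \<rho> ` E" and ne: "e' \<noteq> f'"
    then obtain e f where e: "e \<in> E" "e' = \<rho> ` e" and f: "f \<in> E" "f' = \<rho> ` f" by blast
    have "e \<noteq> f" using ne e f by blast
    then have D: "path_image (\<gamma> e) \<inter> path_image (\<gamma> f) \<subseteq> p ` (e \<inter> f)"
      using d e f by (simp add: plane_drawing_def)
    have ef: "e' \<inter> f' = \<rho> ` (e \<inter> f)"
      using inj_on_image_Int[OF \<rho> E[OF e(1)] E[OF f(1)]] e f by simp
    have "path_image (\<phi> \<circ> \<gamma> (?i ` e')) \<inter> path_image (\<phi> \<circ> \<gamma> (?i ` f'))
        = \<phi> ` (path_image (\<gamma> e) \<inter> path_image (\<gamma> f))"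
      using ie[OF E[OF e(1)]] ie[OF E[OF f(1)]] by (simp add: e f ps image_Int[OF \<phi>(2)])
    also have "\<dots> \<subseteq> \<phi> ` p ` (e \<inter> f)" using D by (rule image_mono)
    also have "\<dots> = (\<lambda>v. \<phi> (p (?i v))) ` (e' \<inter> f')"
      unfolding ef by (rule iV[symmetric]) (use E[OF e(1)] in blast)
    finally show "path_image (\<phi> \<circ> \<gamma> (?i ` e')) \<inter> path_image (\<phi> \<circ> \<gamma> (?i ` f'))
        \<subseteq> (\<lambda>v. \<phi> (p (?i v))) ` (e' \<inter> f')" .
  qed
qed

definition drawing_support :: "'a graph \<Rightarrow> ('a \<Rightarrow> complex) \<Rightarrow> ('a set \<Rightarrow> real \<Rightarrow> complex) \<Rightarrow> complex set" where
  "drawing_support G p \<gamma> = p ` verts G \<union> (\<Union>e\<in>edges G. path_image (\<gamma> e))"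

lemma plane_drawing_one_point_union:
  assumes d1: "plane_drawing (V1, E1) p1 \<gamma>1" and d2: "plane_drawing (V2, E2) p2 \<gamma>2"
    and s1: "simple_graph (V1, E1)" and s2: "simple_graph (V2, E2)"
    and V: "V1 \<inter> V2 = {x}" and x: "p1 x = p2 x"
    and sup: "drawing_support (V1, E1) p1 \<gamma>1 \<inter> drawing_support (V2, E2) p2 \<gamma>2 \<subseteq> {p1 x}"
  shows "planar (V1 \<union> V2, E1 \<union> E2)"
proof -
  define p where "p v = (if v \<in> V1 then p1 v else p2 v)" for v
  define \<gamma> where "\<gamma> e = (if e \<in> E1 then \<gamma>1 e else \<gamma>2 e)" for e
  have e1: "e \<subseteq> V1" "card e = 2" if "e \<in> E1" for e using s1 that by (auto simp: simple_graph_def)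
  have e2: "e \<subseteq> V2" "card e = 2" if "e \<in> E2" for e using s2 that by (auto simp: simple_graph_def)
  have E: "e \<notin> E1" if "e \<in> E2" for e
  proof
    assume "e \<in> E1"
    then have "e \<subseteq> {x}" using e1 e2 that V by blast
    then have "card e \<le> 1" using card_mono[of "{x}" e] by simp
    then show False using e2 that by simp
  qed
  have p2: "p v = p2 v" if "v \<in> V2" for v using that V x by (auto simp: p_def)
  have p1: "p v = p1 v" if "v \<in> V1" for v using that by (simp add: p_def)
  have im1: "p ` S = p1 ` S" if "S \<subseteq> V1" for S by (rule image_cong) (use p1 that in auto)
  have im2: "p ` S = p2 ` S" if "S \<subseteq> V2" for S by (rule image_cong) (use p2 that in auto)
  have D1: "inj_on p1 V1" "\<And>e. e \<in> E1 \<Longrightarrow> arc (\<gamma>1 e)" "\<And>e. e \<in> E1 \<Longrightarrow> {pathstart (\<gamma>1 e), pathfinish (\<gamma>1 e)} = p1 ` e"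
    "\<And>e. e \<in> E1 \<Longrightarrow> path_image (\<gamma>1 e) \<inter> p1 ` V1 = p1 ` e"
    "\<And>e f. e \<in> E1 \<Longrightarrow> f \<in> E1 \<Longrightarrow> e \<noteq> f \<Longrightarrow> path_image (\<gamma>1 e) \<inter> path_image (\<gamma>1 f) \<subseteq> p1 ` (e \<inter> f)"
    using d1 by (simp_all add: plane_drawing_def)
  have D2: "inj_on p2 V2" "\<And>e. e \<in> E2 \<Longrightarrow> arc (\<gamma>2 e)" "\<And>e. e \<in> E2 \<Longrightarrow> {pathstart (\<gamma>2 e), pathfinish (\<gamma>2 e)} = p2 ` e"
    "\<And>e. e \<in> E2 \<Longrightarrow> path_image (\<gamma>2 e) \<inter> p2 ` V2 = p2 ` e"
    "\<And>e f. e \<in> E2 \<Longrightarrow> f \<in> E2 \<Longrightarrow> e \<noteq> f \<Longrightarrow> path_image (\<gamma>2 e) \<inter> path_image (\<gamma>2 f) \<subseteq> p2 ` (e \<inter> f)"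
    using d2 by (simp_all add: plane_drawing_def)
  have xV: "x \<in> V1" "x \<in> V2" using V by auto
  have g1: "\<gamma> e = \<gamma>1 e" if "e \<in> E1" for e using that by (simp add: \<gamma>_def)
  have g2: "\<gamma> e = \<gamma>2 e" if "e \<in> E2" for e using E[OF that] by (simp add: \<gamma>_def)
  \<comment> \<open>All conditions that relate the two drawings reduce to this: a point common to
    both is \<open>p x\<close>, and by \<open>at1\<close> and \<open>at2\<close> an edge through
    \<open>p x\<close> has \<open>x\<close> as an end.\<close>
  have meet: "z = p x" if "z \<in> p ` V1 \<or> (\<exists>e\<in>E1. z \<in> path_image (\<gamma> e))"
      "z \<in> p ` V2 \<or> (\<exists>e\<in>E2. z \<in> path_image (\<gamma> e))" for z
  proof -
    have "z \<in> drawing_support (V1, E1) p1 \<gamma>1"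
      using that(1) im1[OF subset_refl] g1 by (auto simp: drawing_support_def)
    moreover have "z \<in> drawing_support (V2, E2) p2 \<gamma>2"
      using that(2) im2[OF subset_refl] g2 by (auto simp: drawing_support_def)
    ultimately show ?thesis using sup p1[OF xV(1)] by auto
  qed
  have at1: "x \<in> e" if "e \<in> E1" "p x \<in> path_image (\<gamma> e)" for e
  proof -
    have "p1 x \<in> p1 ` e" using D1(4)[OF that(1)] that xV p1 g1 by auto
    then show ?thesis using D1(1) e1[OF that(1)] xV by (meson inj_on_image_mem_iff)
  qed
  have at2: "x \<in> e" if "e \<in> E2" "p x \<in> path_image (\<gamma> e)" for e
  proof -
    have "p2 x \<in> p2 ` e" using D2(4)[OF that(1)] that xV p2 g2 by auto
    then show ?thesis using D2(1) e2[OF that(1)] xV by (meson inj_on_image_mem_iff)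
  qed
  have "plane_drawing (V1 \<union> V2, E1 \<union> E2) p \<gamma>"
    unfolding plane_drawing_def fst_conv snd_conv
  proof (intro conjI ballI impI)
    have "inj_on p V1" "inj_on p V2"
      using D1(1) D2(1) p1 p2 by (simp_all cong: inj_on_cong)
    moreover have "u = v" if uv: "u \<in> V1" "v \<in> V2" "p u = p v" for u v
    proof -
      have "p u \<in> p ` V1" using uv(1) by (rule imageI)
      moreover have "p u \<in> p ` V2" unfolding uv(3) using uv(2) by (rule imageI)
      ultimately have "p u = p x" using meet by blast
      then show ?thesis using inj_onD[OF \<open>inj_on p V1\<close>] inj_onD[OF \<open>inj_on p V2\<close>] uv xV by metis
    qed
    ultimately show "inj_on p (V1 \<union> V2)"
      unfolding inj_on_def by (metis UnE)
  next
    fix e assume "e \<in> E1 \<union> E2"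
    then consider "e \<in> E1" | "e \<in> E2" by blast
    note c = this
    show "arc (\<gamma> e)" using c D1(2) D2(2) g1 g2 by metis
    show "{pathstart (\<gamma> e), pathfinish (\<gamma> e)} = p ` e"
      using c D1(3) D2(3) g1 g2 im1[OF e1(1)] im2[OF e2(1)] by metis
    show "path_image (\<gamma> e) \<inter> p ` (V1 \<union> V2) = p ` e"
    proof (cases rule: c)
      case 1
      have "path_image (\<gamma> e) \<inter> p ` V1 = p ` e"
        using D1(4)[OF 1] g1[OF 1] im1[OF e1(1)[OF 1]] im1[OF subset_refl] by simp
      moreover have "path_image (\<gamma> e) \<inter> p ` V2 \<subseteq> p ` e"
      proof
        fix z assume z: "z \<in> path_image (\<gamma> e) \<inter> p ` V2"
        then have "z = p x" using 1 by (intro meet) auto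
        then show "z \<in> p ` e" using at1[OF 1] z by simp
      qed
      ultimately show ?thesis unfolding image_Un Int_Un_distrib by (simp add: sup_absorb1 sup_absorb2)
    next
      case 2
      have "path_image (\<gamma> e) \<inter> p ` V2 = p ` e"
        using D2(4)[OF 2] g2[OF 2] im2[OF e2(1)[OF 2]] im2[OF subset_refl] by simp
      moreover have "path_image (\<gamma> e) \<inter> p ` V1 \<subseteq> p ` e"
      proof
        fix z assume z: "z \<in> path_image (\<gamma> e) \<inter> p ` V1"
        then have "z = p x" using 2 by (intro meet) auto
        then show "z \<in> p ` e" using at2[OF 2] z by simp
      qed
      ultimately show ?thesis unfolding image_Un Int_Un_distrib by (simp add: sup_absorb1 sup_absorb2)
    qed
  next
    fix e f assume "e \<in> E1 \<union> E2" "f \<in> E1 \<union> E2" and ef: "e \<noteq> f"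
    have mixed: "path_image (\<gamma> a) \<inter> path_image (\<gamma> b) \<subseteq> p ` (a \<inter> b)" if "a \<in> E1" "b \<in> E2" for a b
    proof
      fix z assume z: "z \<in> path_image (\<gamma> a) \<inter> path_image (\<gamma> b)"
      then have "z = p x" using that by (intro meet) auto
      then show "z \<in> p ` (a \<inter> b)" using at1[OF that(1)] at2[OF that(2)] z by simp
    qed
    consider "e \<in> E1" "f \<in> E1" | "e \<in> E2" "f \<in> E2" | "e \<in> E1" "f \<in> E2" | "e \<in> E2" "f \<in> E1"
      using \<open>e \<in> E1 \<union> E2\<close> \<open>f \<in> E1 \<union> E2\<close> by blast
    then show "path_image (\<gamma> e) \<inter> path_image (\<gamma> f) \<subseteq> p ` (e \<inter> f)"
    proof cases
      case 1
      have "e \<inter> f \<subseteq> V1" using e1(1)[OF 1(1)] by blast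
      then show ?thesis using D1(5)[OF 1 ef] g1[OF 1(1)] g1[OF 1(2)] im1 by simp
    next
      case 2
      have "e \<inter> f \<subseteq> V2" using e2(1)[OF 2(1)] by blast
      then show ?thesis using D2(5)[OF 2 ef] g2[OF 2(1)] g2[OF 2(2)] im2 by simp
    next
      case 3
      then show ?thesis by (rule mixed)
    next
      case 4
      then show ?thesis using mixed[of f e] by (simp add: Int_commute)
    qed
  qed
  then show ?thesis unfolding planar_def by blast
qed

lemma planar_subgraph:
  assumes "planar G" "verts H \<subseteq> verts G" "edges H \<subseteq> edges G" "\<And>e. e \<in> edges H \<Longrightarrow> e \<subseteq> verts H"
  shows "planar H"
proof -
  obtain p \<gamma> where d: "plane_drawing G p \<gamma>" using assms(1) unfolding planar_def by blast
  have inj: "inj_on p (verts G)" using d by (simp add: plane_drawing_def)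
  have "plane_drawing H p \<gamma>"
    unfolding plane_drawing_def
  proof (intro conjI ballI impI)
    show "inj_on p (verts H)" using inj assms(2) inj_on_subset by blast
    fix e assume e: "e \<in> edges H"
    then have "e \<in> edges G" using assms(3) by blast
    then have D: "arc (\<gamma> e)" "{pathstart (\<gamma> e), pathfinish (\<gamma> e)} = p ` e"
      "path_image (\<gamma> e) \<inter> p ` verts G = p ` e"
      using d by (simp_all add: plane_drawing_def)
    show "arc (\<gamma> e)" "{pathstart (\<gamma> e), pathfinish (\<gamma> e)} = p ` e" by fact+
    have "p ` e \<subseteq> p ` verts H" "p ` verts H \<subseteq> p ` verts G"
      using assms(2) assms(4)[OF e] by (simp_all add: image_mono)
    moreover have "S \<inter> B = C" if "C \<subseteq> B" "B \<subseteq> A" "S \<inter> A = C" for S A B C :: "complex set"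
      using that by blast
    ultimately show "path_image (\<gamma> e) \<inter> p ` verts H = p ` e" using D(3) by metis
  next
    fix e f assume "e \<in> edges H" "f \<in> edges H" and ef: "e \<noteq> f"
    then have "e \<in> edges G" "f \<in> edges G" using assms(3) by blast+
    then show "path_image (\<gamma> e) \<inter> path_image (\<gamma> f) \<subseteq> p ` (e \<inter> f)"
      using d ef by (simp add: plane_drawing_def)
  qed
  then show ?thesis unfolding planar_def by blast
qed

lemma attach_block:
  fixes V :: "nat set"
  assumes s: "simple_graph (V, E)" and pl: "planar (V, E)" and x: "x \<in> V" and m: "m \<ge> 3"
  obtains B F where "simple_graph (B, F)" "planar (V \<union> B, E \<union> F)" "V \<inter> B = {x}" "card B = m"
    "card F + 6 = 3 * m"
proof -
  obtain p \<gamma>0 where "plane_drawing (V, E) p \<gamma>0"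
    using pl unfolding planar_def by blast
  then interpret drawn_graph V E p \<gamma>0
    by unfold_locales (simp_all add: s)
  obtain \<gamma> d \<eta> where g: "plane_drawing (V, E) p \<gamma>" and d: "d \<noteq> 0" and \<eta>: "\<eta> > 0" and
    free: "\<And>z. z \<in> sector \<eta> \<Longrightarrow> Re z \<le> 2 \<Longrightarrow> p x + d * z \<notin> p ` V \<union> (\<Union>e\<in>E. path_image (\<gamma> e))"
    using free_sector[OF x] by metis
  \<comment> \<open>The steepest slope in the block is below \<open>h * real m\<close>, which is the
    slope of the free sector.\<close>
  define h where "h = \<eta> / real m"
  have h: "h > 0" "h * real m \<le> \<eta>" using \<eta> m by (simp_all add: h_def)
  obtain N where N: "\<And>v. v \<in> V \<Longrightarrow> v < N"
    using finite_verts finite_nat_set_iff_bounded by metis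
  \<comment> \<open>Vertex 0 of the block becomes \<open>x\<close>; the others are shifted past
    every number in \<open>V\<close>.\<close>
  define \<rho> where "\<rho> j = (if j = 0 then x else N + j)" for j
  have \<rho>: "inj_on \<rho> {..<m}" using N[OF x] by (auto simp: inj_on_def \<rho>_def)
  define \<phi> where "\<phi> z = p x + d * z" for z
  have \<phi>: "continuous_on UNIV \<phi>" "inj \<phi>"
    using d by (auto simp: \<phi>_def inj_def intro!: continuous_intros)
  let ?B = "\<rho> ` {..<m}" and ?F = "(`) \<rho> ` block_edges m"
  let ?p = "\<lambda>v. \<phi> (block_pos h (inv_into {..<m} \<rho> v))"
    and ?g = "\<lambda>e. \<phi> \<circ> block_arc h (inv_into {..<m} \<rho> ` e)"
  have m2: "m \<ge> 2" using m by simp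
  have sb: "e \<subseteq> {..<m}" "card e = 2" if "e \<in> block_edges m" for e
    using simple_block[OF m2] that by (auto simp: simple_graph_def)
  have d2: "plane_drawing (?B, ?F) ?p ?g"
    by (rule plane_drawing_transport[OF block_drawing[OF h(1) m2] sb(1) \<rho> \<phi>])
  have sBF: "simple_graph (?B, ?F)"
    unfolding simple_graph_def using sb \<rho> by (auto simp: card_image inj_on_subset)
  have VB: "V \<inter> ?B = {x}"
  proof
    show "{x} \<subseteq> V \<inter> ?B" using x m by (auto simp: \<rho>_def intro: image_eqI[of _ _ 0])
    show "V \<inter> ?B \<subseteq> {x}" using N by (fastforce simp: \<rho>_def)
  qed
  have inv: "inv_into {..<m} \<rho> (\<rho> j) = j" if "j < m" for j using \<rho> that by simp
  have px: "?p x = p x"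
    using inv[of 0] m by (simp add: \<rho>_def \<phi>_def block_pos_def)
  have inve: "inv_into {..<m} \<rho> ` \<rho> ` e = e" if "e \<in> block_edges m" for e
    using sb(1)[OF that] \<rho> by (simp add: inv_into_image_cancel)
  have sup: "drawing_support (V, E) p \<gamma> \<inter> drawing_support (?B, ?F) ?p ?g \<subseteq> {p x}"
  proof
    fix z assume z: "z \<in> drawing_support (V, E) p \<gamma> \<inter> drawing_support (?B, ?F) ?p ?g"
    have "\<exists>w \<in> block_pos h ` {..<m} \<union> (\<Union>e\<in>block_edges m. path_image (block_arc h e)). z = \<phi> w"
    proof -
      have "z \<in> ?p ` ?B \<or> (\<exists>e\<in>block_edges m. z \<in> path_image (?g (\<rho> ` e)))"
        using z by (auto simp: drawing_support_def)
      then show ?thesis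
      proof
        assume "z \<in> ?p ` ?B"
        then obtain j where "j < m" "z = ?p (\<rho> j)" by auto
        then show ?thesis using inv[of j] by auto
      next
        assume "\<exists>e\<in>block_edges m. z \<in> path_image (?g (\<rho> ` e))"
        then obtain e where e: "e \<in> block_edges m" "z \<in> path_image (\<phi> \<circ> block_arc h e)"
          using inve by auto
        then have "z \<in> \<phi> ` path_image (block_arc h e)" by (simp add: path_image_compose)
        then show ?thesis using e by blast
      qed
    qed
    then obtain w where w: "w \<in> block_pos h ` {..<m} \<union> (\<Union>e\<in>block_edges m. path_image (block_arc h e))" "z = \<phi> w"
      by blast
    have "w = 0"
    proof (rule ccontr)
      assume "w \<noteq> 0"
      then have "w \<in> sector \<eta>" "Re w \<le> 2" using block_in_sector[OF h m2 w(1)] by auto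
      then show False using free[of w] z w by (auto simp: drawing_support_def \<phi>_def)
    qed
    then show "z \<in> {p x}" using w by (simp add: \<phi>_def)
  qed
  have "inj_on ((`) \<rho>) (block_edges m)"
    using inj_on_image[of \<rho> "block_edges m"] \<rho> sb(1) by (meson Union_least inj_on_subset)
  then have "card ?F + 6 = 3 * m"
    using card_block_edges[OF m] by (simp add: card_image)
  moreover have "card ?B = m" using \<rho> by (simp add: card_image)
  ultimately show thesis
    using that[of ?B ?F] sBF VB plane_drawing_one_point_union[OF g d2 s sBF VB px[symmetric] sup] by blast
qed

section \<open>Cycles and pendant edges\<close>

lemma contains_iff_embedding:
  assumes H: "simple_graph H"
  shows "contains G H \<longleftrightarrow>
    (\<exists>c. inj_on c (verts H) \<and> c ` verts H \<subseteq> verts G \<and> (\<forall>e\<in>edges H. c ` e \<in> edges G))"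
proof
  assume "contains G H"
  then obtain G' f where G': "subgraph G' G" and f: "bij_betw f (verts G') (verts H)"
    "edges H = (`) f ` edges G'"
    unfolding contains_def isomorphic_def by blast
  let ?c = "inv_into (verts G') f"
  have b: "bij_betw ?c (verts H) (verts G')" by (rule bij_betw_inv_into[OF f(1)])
  have "?c ` e \<in> edges G" if e: "e \<in> edges H" for e
  proof -
    obtain a where a: "a \<in> edges G'" "e = f ` a" using e f(2) by blast
    then have "a \<subseteq> verts G'" using G' by (auto simp: subgraph_def simple_graph_def)
    then have "?c ` e = a" using f(1) a by (simp add: bij_betw_def inv_into_image_cancel)
    then show ?thesis using a G' by (auto simp: subgraph_def)
  qed
  moreover have "?c ` verts H \<subseteq> verts G" using b G' by (simp add: bij_betw_def subgraph_def)
  ultimately show "\<exists>c. inj_on c (verts H) \<and> c ` verts H \<subseteq> verts G \<and> (\<forall>e\<in>edges H. c ` e \<in> edges G)"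
    using b by (intro exI[of _ ?c]) (simp add: bij_betw_def)
next
  assume "\<exists>c. inj_on c (verts H) \<and> c ` verts H \<subseteq> verts G \<and> (\<forall>e\<in>edges H. c ` e \<in> edges G)"
  then obtain c where c: "inj_on c (verts H)" "c ` verts H \<subseteq> verts G" "\<And>e. e \<in> edges H \<Longrightarrow> c ` e \<in> edges G"
    by blast
  let ?G = "(c ` verts H, (`) c ` edges H)"
  have He: "e \<subseteq> verts H" "card e = 2" if "e \<in> edges H" for e
    using H that by (auto simp: simple_graph_def)
  have "subgraph ?G G"
  proof -
    have "c ` e \<subseteq> c ` verts H \<and> card (c ` e) = 2" if "e \<in> edges H" for e
      using He[OF that] c(1) by (simp add: image_mono card_image inj_on_subset)
    moreover have "finite (verts H)" using H by (simp add: simple_graph_def)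
    ultimately have "simple_graph ?G" by (simp add: simple_graph_def)
    then show ?thesis using c by (auto simp: subgraph_def)
  qed
  moreover have "isomorphic ?G H"
  proof -
    let ?f = "inv_into (verts H) c"
    have "bij_betw ?f (c ` verts H) (verts H)"
      using c(1) by (intro bij_betw_inv_into) (simp add: bij_betw_def)
    moreover have "?f ` c ` e = e" if "e \<in> edges H" for e
      using He(1)[OF that] c(1) by (simp add: inv_into_image_cancel)
    then have "edges H = (`) ?f ` (`) c ` edges H"
      by (force simp: image_image)
    ultimately show ?thesis unfolding isomorphic_def by auto
  qed
  ultimately show "contains G H" unfolding contains_def by blast
qed

text \<open>Vertices are not mentioned, as in a simple graph the edges force every
  \<open>c i\<close> to be one. This makes the notion monotone in the edge set and easy to restrict
  to one side of a gluing.\<close>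

definition cycle_in :: "nat \<Rightarrow> (nat \<Rightarrow> 'a) \<Rightarrow> 'a set set \<Rightarrow> bool" where
  "cycle_in k c E \<longleftrightarrow> inj_on c {..<k} \<and> (\<forall>i<k. {c i, c (Suc i mod k)} \<in> E)"

lemma Suc_mod_neq: "k \<ge> 2 \<Longrightarrow> i < k \<Longrightarrow> Suc i mod k \<noteq> i"
  by (cases "Suc i = k") auto

lemma simple_cycle_graph: "k \<ge> 2 \<Longrightarrow> simple_graph (cycle_graph k)"
  unfolding simple_graph_def cycle_graph_def
  using Suc_mod_neq[of k] by (auto simp: card_2_iff)

lemma simple_pendant_cycle_graph:
  assumes "k \<ge> 2"
  shows "simple_graph (pendant_cycle_graph k)"
  using simple_cycle_graph[OF assms] assms
  by (auto simp: simple_graph_def pendant_cycle_graph_def cycle_graph_def)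

lemma contains_cycle_iff:
  assumes "simple_graph G" "k \<ge> 2"
  shows "contains G (cycle_graph k) \<longleftrightarrow> (\<exists>c. cycle_in k c (edges G))"
proof -
  have "c ` {..<k} \<subseteq> verts G" if "\<forall>i<k. {c i, c (Suc i mod k)} \<in> edges G" for c
    using that assms(1) by (fastforce simp: simple_graph_def)
  moreover have "(\<forall>e\<in>edges (cycle_graph k). c ` e \<in> edges G) \<longleftrightarrow> (\<forall>i<k. {c i, c (Suc i mod k)} \<in> edges G)" for c
    unfolding cycle_graph_def setcompr_eq_image by simp
  moreover have "verts (cycle_graph k) = {..<k}"
    by (simp add: cycle_graph_def)
  ultimately show ?thesis
    unfolding contains_iff_embedding[OF simple_cycle_graph[OF assms(2)]] cycle_in_def by metis
qed

lemma contains_pendant_cycle_iff: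
  assumes "simple_graph G" "k \<ge> 2"
  shows "contains G (pendant_cycle_graph k) \<longleftrightarrow>
    (\<exists>c w. cycle_in k c (edges G) \<and> w \<notin> c ` {..<k} \<and> {c 0, w} \<in> edges G)" (is "?L \<longleftrightarrow> ?R")
proof
  assume ?L
  then obtain c where c: "inj_on c (insert k {..<k})" "\<forall>e\<in>edges (pendant_cycle_graph k). c ` e \<in> edges G"
    unfolding contains_iff_embedding[OF simple_pendant_cycle_graph[OF assms(2)]]
    by (auto simp: pendant_cycle_graph_def cycle_graph_def)
  have "{c i, c (Suc i mod k)} \<in> edges G" if "i < k" for i
    using c(2)[rule_format, of "{i, Suc i mod k}"] that by (auto simp: pendant_cycle_graph_def cycle_graph_def)
  moreover have "{c 0, c k} \<in> edges G"
    using c(2)[rule_format, of "{0, k}"] by (auto simp: pendant_cycle_graph_def)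
  moreover have "inj_on c {..<k}" "c k \<notin> c ` {..<k}" using c(1) by auto
  ultimately show ?R unfolding cycle_in_def by blast
next
  assume ?R
  then obtain c w where c: "inj_on c {..<k}" "\<And>i. i < k \<Longrightarrow> {c i, c (Suc i mod k)} \<in> edges G"
    and w: "w \<notin> c ` {..<k}" "{c 0, w} \<in> edges G"
    unfolding cycle_in_def by blast
  let ?c = "c(k := w)"
  have im: "?c ` {..<k} = c ` {..<k}" by (intro image_cong) auto
  have "inj_on ?c (insert k {..<k})"
    using c(1) w(1) im by (auto simp: inj_on_def)
  moreover have eG: "?c ` e \<in> edges G" if "e \<in> edges (pendant_cycle_graph k)" for e
  proof (cases "e = {0, k}")
    case True
    then show ?thesis using w assms(2) by simp
  next
    case False
    moreover have "e \<in> insert {0, k} {{i, Suc i mod k} | i. i < k}"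
      using that by (simp add: pendant_cycle_graph_def cycle_graph_def)
    ultimately obtain i where i: "i < k" "e = {i, Suc i mod k}" by blast
    moreover have "Suc i mod k < k" using assms(2) by simp
    ultimately show ?thesis using c(2)[OF i(1)] by (simp add: less_imp_neq)
  qed
  moreover have "?c ` (insert k {..<k}) \<subseteq> verts G"
  proof -
    have "c i \<in> verts G" if "i < k" for i using c(2)[OF that] assms(1) by (auto simp: simple_graph_def)
    moreover have "w \<in> verts G" using w(2) assms(1) by (auto simp: simple_graph_def)
    ultimately show ?thesis using im by auto
  qed
  ultimately show ?L
    unfolding contains_iff_embedding[OF simple_pendant_cycle_graph[OF assms(2)]]
    by (intro exI[of _ ?c]) (auto simp: pendant_cycle_graph_def cycle_graph_def)
qed

text \<open>Serves to bring a distinguished vertex of the cycle to index 0: the end of the pendant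
  edge, or the cut vertex of a gluing.\<close>

lemma cycle_in_rotate:
  assumes c: "cycle_in k c E" and j: "j < k"
  shows "cycle_in k (\<lambda>i. c ((i + j) mod k)) E"
    "(\<lambda>i. c ((i + j) mod k)) ` {..<k} = c ` {..<k}"
proof -
  let ?r = "\<lambda>i. (i + j) mod k"
  have red: "?r i = (if i + j < k then i + j else i + j - k)" if "i < k" for i
    using that j by (simp add: mod_if)
  have inj: "inj_on ?r {..<k}"
    by (rule inj_onI) (use j in \<open>auto simp: red split: if_splits\<close>)
  have sub: "?r ` {..<k} \<subseteq> {..<k}" using j by auto
  then have r: "?r ` {..<k} = {..<k}"
    using inj by (intro endo_inj_surj) auto
  have "inj_on c (?r ` {..<k})" unfolding r using c by (simp add: cycle_in_def)
  then have "inj_on (c \<circ> ?r) {..<k}" using inj by (rule comp_inj_on[rotated])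
  moreover have "{c (?r i), c (?r (Suc i mod k))} \<in> E" for i
  proof -
    have "?r (Suc i mod k) = Suc (?r i) mod k" by (simp add: mod_simps)
    moreover have "?r i < k" using j by simp
    ultimately show ?thesis using c by (simp add: cycle_in_def)
  qed
  ultimately show "cycle_in k (\<lambda>i. c (?r i)) E" by (simp add: cycle_in_def comp_def)
  show "(\<lambda>i. c (?r i)) ` {..<k} = c ` {..<k}"
    using r by (metis image_image)
qed

text \<open>An edge with exactly one end on the cycle becomes the pendant edge once the cycle is
  rotated to start at that end.\<close>

lemma pendant_free_cycle_isolated:
  assumes G: "simple_graph G" and k: "k \<ge> 2" and free: "\<not> contains G (pendant_cycle_graph k)"
    and c: "cycle_in k c (edges G)" and e: "e \<in> edges G"
  shows "e \<subseteq> c ` {..<k} \<or> e \<subseteq> verts G - c ` {..<k}"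
proof (rule ccontr)
  assume a: "\<not> ?thesis"
  obtain a b where ab: "e = {a, b}" using G e by (auto simp: simple_graph_def card_2_iff)
  have "e \<subseteq> verts G" using G e by (auto simp: simple_graph_def)
  then obtain j w where j: "j < k" "e = {c j, w}" "w \<notin> c ` {..<k}"
    using a ab by (auto simp: insert_commute)
  have "cycle_in k (\<lambda>i. c ((i + j) mod k)) (edges G)" "w \<notin> (\<lambda>i. c ((i + j) mod k)) ` {..<k}"
    using cycle_in_rotate[OF c j(1)] j by auto
  moreover have "{c ((0 + j) mod k), w} \<in> edges G" using j e by simp
  ultimately show False
    using free contains_pendant_cycle_iff[OF G k] by blast
qed

lemma contains_pendant_imp_cycle:
  assumes "simple_graph G" "k \<ge> 2" "contains G (pendant_cycle_graph k)"
  shows "contains G (cycle_graph k)"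
  using assms contains_pendant_cycle_iff contains_cycle_iff by blast

text \<open>Rotating the cycle so that the cut vertex comes first, the remaining vertices form a path
  avoiding the cut vertex and thus stay on one side.\<close>

lemma cycle_in_one_point_union:
  assumes s: "simple_graph (V, E)" "simple_graph (B, F)" and VB: "V \<inter> B = {x}"
    and B: "card B < k" and k: "k \<ge> 2" and c: "cycle_in k c (E \<union> F)"
  shows "\<exists>c. cycle_in k c E"
proof -
  \<comment> \<open>If the cycle avoids the cut vertex, any starting index will do, and 0 is
    taken.\<close>
  obtain z where z: "z < k" "\<And>i. i < k \<Longrightarrow> c i = x \<Longrightarrow> i = z"
  proof (cases "\<exists>i<k. c i = x")
    case True
    then obtain i where i: "i < k" "c i = x" by blast
    have "inj_on c {..<k}" using c by (simp add: cycle_in_def)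
    then have "j = i" if "j < k" "c j = x" for j using i that by (auto dest: inj_onD)
    then show thesis using that i(1) by blast
  next
    case False
    then show thesis using that[of 0] k by auto
  qed
  define d where "d i = c ((i + z) mod k)" for i
  have d: "cycle_in k d (E \<union> F)"
    unfolding d_def by (rule cycle_in_rotate(1)[OF c z(1)])
  have dx: "d i \<noteq> x" if "0 < i" "i < k" for i
  proof
    assume "d i = x"
    then have "(i + z) mod k = z" using z k by (simp add: d_def)
    then show False using that z(1) by (auto simp: mod_if split: if_splits)
  qed
  have E: "e \<subseteq> V" if "e \<in> E" for e using s that by (auto simp: simple_graph_def)
  have F: "e \<subseteq> B" if "e \<in> F" for e using s that by (auto simp: simple_graph_def)
  have edge: "{d i, d (Suc i mod k)} \<in> E \<union> F" if "i < k" for i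
    using d that by (simp add: cycle_in_def)
  have VnB: "v \<notin> B" if "v \<in> V" "v \<noteq> x" for v using that VB by blast
  have step: "d i \<in> V \<longleftrightarrow> d (Suc i) \<in> V" if "0 < i" "Suc i < k" for i
  proof -
    have "{d i, d (Suc i)} \<in> E \<union> F" using edge[of i] that by simp
    then have "{d i, d (Suc i)} \<subseteq> V \<or> {d i, d (Suc i)} \<subseteq> B"
      using E[of "{d i, d (Suc i)}"] F[of "{d i, d (Suc i)}"] by auto
    then show ?thesis using VnB[of "d i"] VnB[of "d (Suc i)"] dx[of i] dx[of "Suc i"] that by auto
  qed
  have side: "d i \<in> V \<longleftrightarrow> d 1 \<in> V" if "0 < i" "i < k" for i
    using that
  proof (induction i)
    case (Suc i)
    then show ?case using step[of i] by (cases "i = 0") auto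
  qed simp
  \<comment> \<open>Every edge of the cycle has an end of nonzero index. That end is not the cut
    vertex, so it decides to which side the edge belongs.\<close>
  have other: "\<exists>j\<in>{i, Suc i mod k}. 0 < j \<and> j < k" if "i < k" for i
  proof (cases "i = 0")
    case True
    then show ?thesis using k by simp
  qed (use that in auto)
  show ?thesis
  proof (cases "d 1 \<in> V")
    case True
    have "{d i, d (Suc i mod k)} \<in> E" if i: "i < k" for i
    proof -
      obtain j where "j \<in> {i, Suc i mod k}" "0 < j" "j < k" using other[OF i] by blast
      then have "d j \<notin> B" "d j \<in> {d i, d (Suc i mod k)}"
        using side[of j] True dx[of j] VnB[of "d j"] by auto
      then have "{d i, d (Suc i mod k)} \<notin> F" using F by (meson subsetD)
      then show ?thesis using edge[OF i] by simp
    qed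
    then have "cycle_in k d E" using d by (simp add: cycle_in_def)
    then show ?thesis by blast
  next
    case False
    have "d i \<in> B" if i: "i < k" for i
    proof -
      obtain j where "j \<in> {i, Suc i mod k}" "0 < j" "j < k" using other[OF i] by blast
      then have "d j \<notin> V" "d j \<in> {d i, d (Suc i mod k)}" using side[of j] False by auto
      then have "{d i, d (Suc i mod k)} \<notin> E" using E by (meson subsetD)
      then have "{d i, d (Suc i mod k)} \<in> F" using edge[OF i] by simp
      then show ?thesis using F by (meson insertI1 subsetD)
    qed
    \<comment> \<open>A cycle on the side of the block would need \<open>k\<close> vertices there,
      and the block has fewer.\<close>
    then have "d ` {..<k} \<subseteq> B" by auto
    moreover have "finite B" using s by (simp add: simple_graph_def)
    moreover have "card (d ` {..<k}) = k" using d by (simp add: cycle_in_def card_image)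
    ultimately have "k \<le> card B" using card_mono by metis
    then show ?thesis using B by simp
  qed
qed

text \<open>The number of edges is only bounded below: for comparing maxima it suffices to do at
  least as well, and any surplus can be carried through the trades.\<close>

definition cycle_free_planar :: "nat \<Rightarrow> nat \<Rightarrow> nat \<Rightarrow> bool" where
  "cycle_free_planar k n m \<longleftrightarrow> (\<exists>G :: nat graph. simple_graph G \<and> planar G \<and> card (verts G) = n \<and>
     \<not> contains G (cycle_graph k) \<and> m \<le> card (edges G))"

lemma cycle_free_planar_single:
  assumes "k \<ge> 2"
  shows "cycle_free_planar k 1 0"
proof -
  let ?G = "({0}, {}) :: nat graph"
  have "plane_drawing ?G (\<lambda>_. 0) (\<lambda>_ _. 0)" by (simp add: plane_drawing_def)
  then have "planar ?G" unfolding planar_def by blast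
  moreover have s: "simple_graph ?G" by (simp add: simple_graph_def)
  moreover have "\<not> contains ?G (cycle_graph k)"
    using assms contains_cycle_iff[OF s assms] by (auto simp: cycle_in_def intro!: exI[of _ 0])
  ultimately show ?thesis unfolding cycle_free_planar_def by fastforce
qed

text \<open>The cut vertex is counted once, hence \<open>n + m - 1\<close>, and it exists by
  \<open>n \<ge> 1\<close>. As \<open>m < k\<close>, no cycle on \<open>k\<close> vertices fits
  inside the block, and a cycle cannot pass through the cut vertex into both sides.\<close>

lemma cycle_free_planar_attach:
  assumes g: "cycle_free_planar k n e" and n: "n \<ge> 1" and m: "m \<ge> 3" "m < k"
  shows "cycle_free_planar k (n + m - 1) (e + 3 * m - 6)"
proof -
  obtain G0 :: "nat graph" where G0: "simple_graph G0" "planar G0" "card (verts G0) = n" "e \<le> card (edges G0)"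
    "\<not> contains G0 (cycle_graph k)"
    using g unfolding cycle_free_planar_def by blast
  obtain V E where "G0 = (V, E)" by (cases G0)
  with G0 have G: "simple_graph (V, E)" "planar (V, E)" "card V = n" "e \<le> card E"
    and free: "\<not> contains (V, E) (cycle_graph k)"
    by simp_all
  obtain x where x: "x \<in> V" using G(3) n by fastforce
  obtain B F where B: "simple_graph (B, F)" "planar (V \<union> B, E \<union> F)" "V \<inter> B = {x}" "card B = m"
    "card F + 6 = 3 * m"
    using attach_block[OF G(1,2) x m(1)] by metis
  have k: "k \<ge> 2" using m by simp
  have fin: "finite V" "finite B" "finite E" "finite F"
    using G(1) B(1) finite_subset[of E "Pow V"] finite_subset[of F "Pow B"]
    by (auto simp: simple_graph_def)
  have s: "simple_graph (V \<union> B, E \<union> F)"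
    using G(1) B(1) by (auto simp: simple_graph_def)
  have "\<not> contains (V \<union> B, E \<union> F) (cycle_graph k)"
    using cycle_in_one_point_union[OF G(1) B(1,3) _ k] B(4) m free
      contains_cycle_iff[OF G(1) k] contains_cycle_iff[OF s k] by auto
  moreover have "card (V \<union> B) = n + m - 1"
    using card_Un_Int[OF fin(1,2)] B(3,4) G(3) by simp
  moreover have "card (E \<union> F) = card E + card F"
  proof (rule card_Un_disjoint[OF fin(3,4)])
    have "a \<notin> F" if "a \<in> E" for a
    proof
      assume "a \<in> F"
      then have "a \<subseteq> V \<inter> B" "card a = 2"
        using that G(1) B(1) by (auto simp: simple_graph_def)
      then have "a \<subseteq> {x}" "card a = 2" using B(3) by simp_all
      then show False using card_mono[of "{x}" a] by simp
    qed
    then show "E \<inter> F = {}" by blast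
  qed
  ultimately show ?thesis
    unfolding cycle_free_planar_def using s B(2,5) G(4)
    by (intro exI[of _ "(V \<union> B, E \<union> F)"]) simp
qed

lemma cycle_free_planar_mono: "cycle_free_planar k n m \<Longrightarrow> m' \<le> m \<Longrightarrow> cycle_free_planar k n m'"
  unfolding cycle_free_planar_def using order_trans by blast

text \<open>Strong induction on the number of vertices. The component spanned by a cycle is split
  off, the remainder on \<open>n - k\<close> vertices is made free of such cycles, and two blocks
  glued to it restore the number of vertices without losing edges.\<close>

lemma pendant_free_imp_cycle_free_planar:
  fixes G :: "nat graph"
  assumes k: "k \<ge> 5"
  shows "\<lbrakk>simple_graph G; planar G; card (verts G) = n; n \<ge> k + 1; \<not> contains G (pendant_cycle_graph k)\<rbrakk>
    \<Longrightarrow> cycle_free_planar k n (card (edges G))"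
proof (induction n arbitrary: G rule: less_induct)
  case (less n G)
  have k2: "k \<ge> 2" using k by simp
  show ?case
  proof (cases "contains G (cycle_graph k)")
    case False
    then show ?thesis unfolding cycle_free_planar_def using less.prems by blast
  next
    case True
    then obtain c where c: "cycle_in k c (edges G)"
      using contains_cycle_iff[OF less.prems(1) k2] by blast
    define W where "W = c ` {..<k}"
    define G1 where "G1 = (W, {e \<in> edges G. e \<subseteq> W})"
    define G2 where "G2 = (verts G - W, {e \<in> edges G. e \<subseteq> verts G - W})"
    have fin: "finite (verts G)" "finite (edges G)"
      using less.prems(1) finite_subset[of "edges G" "Pow (verts G)"] by (auto simp: simple_graph_def)
    have cW: "card W = k" using c by (simp add: W_def cycle_in_def card_image)
    have WV: "W \<subseteq> verts G"
      using c less.prems(1) by (fastforce simp: W_def cycle_in_def simple_graph_def)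
    have s: "simple_graph G1" "simple_graph G2"
      using less.prems(1) WV finite_subset[OF WV]
      by (auto simp: G1_def G2_def simple_graph_def)
    have pl: "planar G1" "planar G2"
      by (rule planar_subgraph[OF less.prems(2)]; use WV in \<open>auto simp: G1_def G2_def\<close>)+
    have split: "edges G = edges G1 \<union> edges G2"
      using pendant_free_cycle_isolated[OF less.prems(1) k2 less.prems(5) c]
      by (auto simp: G1_def G2_def W_def)
    have disj: "edges G1 \<inter> edges G2 = {}"
    proof -
      have False if "e \<in> edges G1" "e \<in> edges G2" for e
      proof -
        have "e = {}" using that by (auto simp: G1_def G2_def)
        moreover have "card e = 2" using s(1) that by (auto simp: simple_graph_def)
        ultimately show False by simp
      qed
      then show ?thesis by blast
    qed
    have "finite (edges G1)" "finite (edges G2)" using fin by (simp_all add: G1_def G2_def)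
    then have cE: "card (edges G) = card (edges G1) + card (edges G2)"
      unfolding split using disj by (rule card_Un_disjoint)
    have v1: "card (verts G1) = k" using cW by (simp add: G1_def)
    have v2: "card (verts G2) = n - k"
      using card_Diff_subset[of W "verts G"] WV cW less.prems(3) finite_subset[OF WV fin(1)]
      by (simp add: G2_def)
    have e1: "card (edges G1) + 6 \<le> 3 * k"
      using planar_card_edges_le[OF s(1) pl(1)] v1 k by simp
    show ?thesis
    \<comment> \<open>Here the remainder has exactly \<open>k\<close> vertices: the induction
      hypothesis asks for more, and a cycle on \<open>k\<close> vertices is not excluded by
      counting.\<close>
    proof (cases "n = 2 * k")
      case True
      then have "card (edges G2) + 6 \<le> 3 * k"
        using planar_card_edges_le[OF s(2) pl(2)] v2 k by simp
      then have le: "card (edges G) \<le> 6 * k - 12" using e1 cE by simp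
      \<comment> \<open>Start from a single vertex and attach blocks of sizes \<open>k - 1\<close>,
        \<open>k - 1\<close> and \<open>4\<close>: 1 + (k - 2) + (k - 2) + 3 = 2k vertices and 2(3k
        - 9) + 6 = 6k - 12 edges. The sums are kept in the form that
        \<open>cycle_free_planar_attach\<close> yields; \<open>k \<ge> 5\<close> makes all
        subtractions exact.\<close>
      have "cycle_free_planar k (1 + (k - 1) - 1) (0 + 3 * (k - 1) - 6)"
        by (rule cycle_free_planar_attach[OF cycle_free_planar_single[OF k2]]) (use k in auto)
      then have "cycle_free_planar k (1 + (k - 1) - 1 + (k - 1) - 1) (0 + 3 * (k - 1) - 6 + 3 * (k - 1) - 6)"
        by (rule cycle_free_planar_attach) (use k in auto)
      then have cf: "cycle_free_planar k (1 + (k - 1) - 1 + (k - 1) - 1 + 4 - 1)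
          (0 + 3 * (k - 1) - 6 + 3 * (k - 1) - 6 + 3 * 4 - 6)"
        by (rule cycle_free_planar_attach) (use k in auto)
      have eq: "1 + (k - 1) - 1 + (k - 1) - 1 + 4 - 1 = n" using k True by simp
      have "0 + 3 * (k - 1) - 6 + 3 * (k - 1) - 6 + 3 * 4 - 6 = 6 * k - 12" using k by simp
      then have "card (edges G) \<le> 0 + 3 * (k - 1) - 6 + 3 * (k - 1) - 6 + 3 * 4 - 6" using le by simp
      then show ?thesis by (rule cycle_free_planar_mono[OF cf[unfolded eq]])
    next
      case False
      have "cycle_free_planar k (n - k) (card (edges G2))"
      proof (cases "n - k \<ge> k + 1")
        case True
        have "\<not> contains G2 (pendant_cycle_graph k)"
          using less.prems(5) split unfolding contains_pendant_cycle_iff[OF s(2) k2]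
            contains_pendant_cycle_iff[OF less.prems(1) k2] by (auto simp: cycle_in_def)
        then show ?thesis using less.IH[of "n - k" G2] s(2) pl(2) v2 True k by simp
      next
        \<comment> \<open>As \<open>n - k\<close> is not \<open>k\<close> either, the remainder has
          fewer than \<open>k\<close> vertices.\<close>
        case small: False
        have "\<not> contains G2 (cycle_graph k)"
        proof
          assume "contains G2 (cycle_graph k)"
          then obtain b where b: "cycle_in k b (edges G2)"
            using contains_cycle_iff[OF s(2) k2] by blast
          have "b ` {..<k} \<subseteq> verts G2"
            using b s(2) by (fastforce simp: cycle_in_def simple_graph_def)
          moreover have "card (b ` {..<k}) = k" using b by (simp add: cycle_in_def card_image)
          moreover have "finite (verts G2)" using s(2) by (simp add: simple_graph_def)
          ultimately have "k \<le> n - k" using card_mono v2 by metis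
          then show False using small False by simp
        qed
        then show ?thesis unfolding cycle_free_planar_def using s(2) pl(2) v2 by blast
      qed
      then have "cycle_free_planar k (n - k + (k - 1) - 1) (card (edges G2) + 3 * (k - 1) - 6)"
        by (rule cycle_free_planar_attach) (use k less.prems in auto)
      then have cf: "cycle_free_planar k (n - k + (k - 1) - 1 + 3 - 1) (card (edges G2) + 3 * (k - 1) - 6 + 3 * 3 - 6)"
        by (rule cycle_free_planar_attach) (use k less.prems in auto)
      have eq: "n - k + (k - 1) - 1 + 3 - 1 = n" using k less.prems by simp
      have "card (edges G) \<le> card (edges G2) + 3 * (k - 1) - 6 + 3 * 3 - 6"
        using cE e1 k by simp
      then show ?thesis by (rule cycle_free_planar_mono[OF cf[unfolded eq]])
    qed
  qed
qed

theorem theorem3p2: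
  fixes n k :: nat
  assumes "n \<ge> k + 1" and "k \<ge> 5"
  shows "ex_planar n (pendant_cycle_graph k) = ex_planar n (cycle_graph k)"
proof -
  let ?P = "planar_free_sizes n (pendant_cycle_graph k)" and ?C = "planar_free_sizes n (cycle_graph k)"
  have k2: "k \<ge> 2" using assms by simp
  have CP: "?C \<subseteq> ?P"
    unfolding planar_free_sizes_def using contains_pendant_imp_cycle[OF _ k2] by blast
  have "edges (cycle_graph k) \<noteq> {}" using k2 by (auto simp: cycle_graph_def intro!: exI[of _ 0])
  then have ne: "?C \<noteq> {}" by (rule planar_free_sizes_nonempty)
  have fin: "finite ?C" "finite ?P" by (rule finite_planar_free_sizes)+
  \<comment> \<open>The trades may change the graph entirely, but they keep the number of vertices
    and do not lower the number of edges, which is enough to compare the maxima.\<close>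
  have dom: "\<exists>b\<in>?C. a \<le> b" if a: "a \<in> ?P" for a
  proof -
    obtain G :: "nat graph" where "a = card (edges G)" "simple_graph G" "planar G" "card (verts G) = n"
      "\<not> contains G (pendant_cycle_graph k)"
      using a unfolding planar_free_sizes_def by blast
    then have "cycle_free_planar k n a"
      using pendant_free_imp_cycle_free_planar[OF assms(2)] assms(1) by blast
    then show ?thesis unfolding cycle_free_planar_def planar_free_sizes_def by blast
  qed
  have "Max ?P \<in> ?P" using fin ne CP by (intro Max_in) auto
  then have "Max ?P \<le> Max ?C" using dom fin Max_ge by (meson order_trans)
  moreover have "Max ?C \<le> Max ?P" using CP ne fin by (intro Max_mono) auto
  ultimately show ?thesis by (simp add: ex_planar_def)
qed

end
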